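(* Let $\varphi$ be a Musielak--Orlicz function on $\Omega\times[0,\infty)$ which is of uniformly lower type $p_\varphi^-$ for some $p_\varphi^-\in(0,\infty)$ and of uniformly upper type $p_\varphi^+$ for some $p_\varphi^+\in(0,\infty)$. If $q\in(\max\{p_\varphi^+,1\},\infty]$, then $$WH_\varphi^s(\Omega)=WH_{\rm at}^{\varphi,q,s}(\Omega)$$ with equivalent quasi-norms, i.e. the two sets of martingales coincide and there is a constant $C\in[1,\infty)$ such that $C^{-1}\|f\|_{WH_\varphi^s(\Omega)}\le\|f\|_{WH_{\rm at}^{\varphi,q,s}(\Omega)}\le C\|f\|_{WH_\varphi^s(\Omega)}$ for all $f$ in this common set.
   Context: Setting. $(\Omega,\mathcal F,\mathbb P)$ is a probability space, $\{\mathcal F_n\}_{n\in\mathbb Z_+}$ ($\mathbb Z_+=\{0,1,2,\dots\}$, $\mathbb N=\{1,2,\dots\}$) is an increasing sequence of sub-$\sigma$-algebras of $\mathcal F$, and $\mathbb E_n$ is the conditional expectation given $\mathcal F_n$. Musielak--Orlicz functions. $\varphi:\Omega\times[0,\infty)\to[0,\infty)$ is a Musielak--Orlicz function if $\varphi(\cdot,t)$ is measurable for each $t\in[0,\infty)$ and, for each $x\in\Omega$, $\varphi(x,\cdot)$ is non-decreasing, $\varphi(x,0)=0$, $\varphi(x,t)>0$ for $t\in(0,\infty)$, and $\lim_{t\to\infty}\varphi(x,t)=\infty$. It is of uniformly lower (resp. upper) type $p\in(0,\infty)$ if there is a constant $C_{(p)}>0$ with $\varphi(x,st)\le C_{(p)}s^p\varphi(x,t)$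 for all $x\in\Omega$, $t\in[0,\infty)$ and $s\in(0,1)$ (resp. $s\in[1,\infty)$). Standing assumption: $\int_\Omega\varphi(x,t)\,d\mathbb P(x)<\infty$ for every $t\in(0,\infty)$. For measurable $E\subseteq\Omega$, $\varphi(E,t):=\int_E\varphi(x,t)\,d\mathbb P(x)$. Weak space. $\|f\|_{WL_\varphi(\Omega)}:=\inf\{\lambda\in(0,\infty):\ \sup_{\alpha\in(0,\infty)}\varphi(\{x\in\Omega:|f(x)|>\alpha\},\alpha/\lambda)\le1\}$, and $WL_\varphi(\Omega)$ is the set of measurable $f$ with $\|f\|_{WL_\varphi(\Omega)}<\infty$. Also $\|f\|_{L^\varphi(\Omega)}:=\inf\{\lambda\in(0,\infty):\int_\Omega\varphi(x,|f(x)|/\lambda)\,d\mathbb P(x)\le1\}$. Martingales. $\mathcal M$ is the set of martingales $f=(f_n)_{n\in\mathbb Z_+}$ with respect to $\{\mathcal F_n\}$ with $f_0=0$; $d_nf:=f_n-f_{n-1}$ for $n\in\mathbb N$; $s(f):=(\sum_{i=1}^\infty\mathbb E_{i-1}|d_if|^2)^{1/2}$. $WH_\varphi^s(\Omega):=\{f\in\mathcal M:\|f\|_{WH_\varphi^s(\Omega)}:=\|s(f)\|_{WL_\varphi(\Omega)}<\infty\}$. Atoms. For a stopping time $\nu$ (with values in $\mathbb Z_+\cup\{\infty\}$) let $B_\nu:=\{x\in\Omega:\nu(x)<\infty\}$. For measurable $B\subseteq\Omega$, $\|g\|_{L_\varphi^q(B)}:=\sup_{t\in(0,\infty)}\left[\frac1{\varphi(B,t)}\int_\Omega|g(x)|^q\varphi(x,t)\,d\mathbb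 P(x)\right]^{1/q}$ if $q\in[1,\infty)$, and $\|g\|_{L_\varphi^\infty(B)}:=\|g\|_{L^\infty(\Omega)}$. For $q\in(1,\infty]$, an (integrable) measurable function $a$ is a $(\varphi,q)_s$-atom if there is a stopping time $\nu$ (the stopping time associated with $a$) such that (i) for every $n\in\mathbb Z_+$, $a_n:=\mathbb E_n a=0$ on $\{\nu\ge n\}$; (ii) $\|s(a)\|_{L_\varphi^q(B_\nu)}\le\|\mathbf 1_{B_\nu}\|_{L^\varphi(\Omega)}^{-1}$, where $s(a)$ is that of the martingale $(a_n)_n$. If $\mathbb P(B_\nu)=0$, then all $a_n=0$ a.e. and (ii) is regarded as satisfied. Atomic space. Fix a constant $\widetilde C\in(0,\infty)$ (independent of $f$; the equivalence constants may depend on it). $WH_{\rm at}^{\varphi,q,s}(\Omega)$ is the set of $f\in\mathcal M$ for which there is a sequence of $(\varphi,q)_s$-atoms $\{a^k\}_{k\in\mathbb Z}$ with associated stopping times $\{\nu^k\}_{k\in\mathbb Z}$ such that, for every $n\in\mathbb Z_+$, $f_n=\sum_{k\in\mathbb Z}\mu^ka_n^k$ $\mathbb P$-a.e., where $\mu^k:=\widetilde C2^k\|\mathbf 1_{B_{\nu^k}}\|_{L^\varphi(\Omega)}$, and $\|f\|_{WH_{\rm at}^{\varphi,q,s}(\Omega)}:=\inf\left\{\inf\left\{\lambda\in(0,\infty):\sup_{k\in\mathbb Z}\varphi(B_{\nu^k},2^k/\lambda)\le1\right\}\right\}<\infty$, the outer infimum being over all such decompositions of $f$. *)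

theory Defs
  imports "HOL-Probability.Probability"
begin

section \<open>Musielak--Orlicz functions\<close>

text \<open>Only the values \<^term>\<open>\<phi> x t\<close> with \<^term>\<open>x \<in> space M\<close> and \<^term>\<open>t \<ge> (0::real)\<close> are relevant.\<close>

definition musielak_orlicz :: "'a measure \<Rightarrow> ('a \<Rightarrow> real \<Rightarrow> real) \<Rightarrow> bool" where
  "musielak_orlicz M \<phi> \<longleftrightarrow>
     (\<forall>t\<ge>0. (\<lambda>x. \<phi> x t) \<in> borel_measurable M) \<and>
     (\<forall>x\<in>space M. mono_on {0..} (\<phi> x) \<and> \<phi> x 0 = 0 \<and> (\<forall>t>0. \<phi> x t > 0) \<and>
        filterlim (\<phi> x) at_top at_top)"

definition uniformly_lower_type :: "'a measure \<Rightarrow> ('a \<Rightarrow> real \<Rightarrow> real) \<Rightarrow> real \<Rightarrow> bool" where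
  "uniformly_lower_type M \<phi> p \<longleftrightarrow>
     (\<exists>C>0. \<forall>x\<in>space M. \<forall>t\<ge>0. \<forall>s\<in>{0<..<1}. \<phi> x (s * t) \<le> C * s powr p * \<phi> x t)"

definition uniformly_upper_type :: "'a measure \<Rightarrow> ('a \<Rightarrow> real \<Rightarrow> real) \<Rightarrow> real \<Rightarrow> bool" where
  "uniformly_upper_type M \<phi> p \<longleftrightarrow>
     (\<exists>C>0. \<forall>x\<in>space M. \<forall>t\<ge>0. \<forall>s\<ge>1. \<phi> x (s * t) \<le> C * s powr p * \<phi> x t)"

definition phi_mass :: "'a measure \<Rightarrow> ('a \<Rightarrow> real \<Rightarrow> real) \<Rightarrow> 'a set \<Rightarrow> real \<Rightarrow> ennreal" where
  "phi_mass M \<phi> E t = (\<integral>\<^sup>+x\<in>E. ennreal (\<phi> x t) \<partial>M)"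

section \<open>Quasi-norms\<close>

text \<open>All quasi-norms take values in \<^typ>\<open>ennreal\<close>; an infimum over the empty set is infinite.
  The function \<open>s(f)\<close> below may take the value infinity, so the quasi-norms that are applied
  to it are stated for \<^typ>\<open>ennreal\<close>-valued \<open>g\<close>, which plays the role of the modulus.\<close>

definition ennpowr :: "ennreal \<Rightarrow> real \<Rightarrow> ennreal" where
  "ennpowr x r = (if x = \<infinity> then \<infinity> else ennreal (enn2real x powr r))"
  \<comment> \<open>used for \<open>r > 0\<close> only\<close>

definition WL_norm :: "'a measure \<Rightarrow> ('a \<Rightarrow> real \<Rightarrow> real) \<Rightarrow> ('a \<Rightarrow> ennreal) \<Rightarrow> ennreal" where
  "WL_norm M \<phi> g =
     Inf (ennreal ` {l. 0 < l \<and>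
       (SUP \<alpha>\<in>{0<..}. phi_mass M \<phi> {x\<in>space M. ennreal \<alpha> < g x} (\<alpha> / l)) \<le> 1})"

definition L_norm :: "'a measure \<Rightarrow> ('a \<Rightarrow> real \<Rightarrow> real) \<Rightarrow> ('a \<Rightarrow> real) \<Rightarrow> ennreal" where
  "L_norm M \<phi> f =
     Inf (ennreal ` {l. 0 < l \<and> (\<integral>\<^sup>+x. ennreal (\<phi> x (\<bar>f x\<bar> / l)) \<partial>M) \<le> 1})"

definition Lq_norm ::
  "'a measure \<Rightarrow> ('a \<Rightarrow> real \<Rightarrow> real) \<Rightarrow> ennreal \<Rightarrow> 'a set \<Rightarrow> ('a \<Rightarrow> ennreal) \<Rightarrow> ennreal" where
  "Lq_norm M \<phi> q B g =
     (if q = \<infinity> then esssup M g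
      else (SUP t\<in>{0<..}.
              ennpowr (1 / phi_mass M \<phi> B t *
                         (\<integral>\<^sup>+x. ennpowr (g x) (enn2real q) * ennreal (\<phi> x t) \<partial>M))
                      (1 / enn2real q)))"

section \<open>Martingales\<close>

definition martingales0 :: "'a measure \<Rightarrow> (nat \<Rightarrow> 'a measure) \<Rightarrow> (nat \<Rightarrow> 'a \<Rightarrow> real) set" where
  "martingales0 M F =
     {f. (\<forall>n. f n \<in> borel_measurable (F n) \<and> integrable M (f n)) \<and>
         (\<forall>m n. m \<le> n \<longrightarrow> (AE x in M. real_cond_exp M (F m) (f n) x = f m x)) \<and>
         (AE x in M. f 0 x = 0)}"

definition mdiff :: "(nat \<Rightarrow> 'a \<Rightarrow> real) \<Rightarrow> nat \<Rightarrow> 'a \<Rightarrow> real" where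
  "mdiff f n x = f n x - f (n - 1) x"  \<comment> \<open>used for \<open>n \<ge> 1\<close> only\<close>

text \<open>The sum over \<open>i \<ge> 1\<close> of \<open>E\<^sub>i\<^sub>-\<^sub>1 |d\<^sub>i f|\<^sup>2\<close> is indexed by \<open>j = i - 1\<close>. The martingale need
  not be square integrable, hence the conditional expectations are the extended ones.\<close>

definition cond_square ::
  "'a measure \<Rightarrow> (nat \<Rightarrow> 'a measure) \<Rightarrow> (nat \<Rightarrow> 'a \<Rightarrow> real) \<Rightarrow> 'a \<Rightarrow> ennreal" where
  "cond_square M F f x =
     ennpowr (\<Sum>j. nn_cond_exp M (F j) (\<lambda>y. ennreal (\<bar>mdiff f (Suc j) y\<bar>\<^sup>2)) x) (1/2)"

definition WHs_norm ::
  "'a measure \<Rightarrow> (nat \<Rightarrow> 'a measure) \<Rightarrow> ('a \<Rightarrow> real \<Rightarrow> real) \<Rightarrow> (nat \<Rightarrow> 'a \<Rightarrow> real) \<Rightarrow> ennreal" where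
  "WHs_norm M F \<phi> f = WL_norm M \<phi> (cond_square M F f)"

definition WHs ::
  "'a measure \<Rightarrow> (nat \<Rightarrow> 'a measure) \<Rightarrow> ('a \<Rightarrow> real \<Rightarrow> real) \<Rightarrow> (nat \<Rightarrow> 'a \<Rightarrow> real) set" where
  "WHs M F \<phi> = {f \<in> martingales0 M F. WHs_norm M F \<phi> f < \<infinity>}"

section \<open>Atoms and the atomic space\<close>

text \<open>The library's \<^const>\<open>stopping_time\<close> takes its values in the index set of the filtration;
  here the value infinity is allowed in addition.\<close>

definition ext_stopping_time :: "(nat \<Rightarrow> 'a measure) \<Rightarrow> ('a \<Rightarrow> enat) \<Rightarrow> bool" where
  "ext_stopping_time F \<nu> \<longleftrightarrow> (\<forall>n. Measurable.pred (F n) (\<lambda>x. \<nu> x \<le> enat n))"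

definition B_set :: "'a measure \<Rightarrow> ('a \<Rightarrow> enat) \<Rightarrow> 'a set" where
  "B_set M \<nu> = {x\<in>space M. \<nu> x < \<infinity>}"

text \<open>\<open>satom M F \<phi> q \<nu> a\<close>: \<open>a\<close> is a \<open>(\<phi>,q)\<^sub>s\<close>-atom with associated stopping time \<open>\<nu>\<close>.\<close>

definition satom ::
  "'a measure \<Rightarrow> (nat \<Rightarrow> 'a measure) \<Rightarrow> ('a \<Rightarrow> real \<Rightarrow> real) \<Rightarrow> ennreal \<Rightarrow>
   ('a \<Rightarrow> enat) \<Rightarrow> ('a \<Rightarrow> real) \<Rightarrow> bool" where
  "satom M F \<phi> q \<nu> a \<longleftrightarrow>
     integrable M a \<and> ext_stopping_time F \<nu> \<and>
     (\<forall>n. AE x in M. enat n \<le> \<nu> x \<longrightarrow> real_cond_exp M (F n) a x = 0) \<and>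
     (emeasure M (B_set M \<nu>) = 0 \<or>
      Lq_norm M \<phi> q (B_set M \<nu>) (cond_square M F (\<lambda>n. real_cond_exp M (F n) a))
        \<le> inverse (L_norm M \<phi> (indicator (B_set M \<nu>))))"

text \<open>In the setting of the theorem \<^term>\<open>L_norm M \<phi> (indicator (B_set M \<nu>))\<close> is always finite, so
  that no information is lost by \<^const>\<open>enn2real\<close>.\<close>

definition atom_coeff ::
  "'a measure \<Rightarrow> ('a \<Rightarrow> real \<Rightarrow> real) \<Rightarrow> real \<Rightarrow> (int \<Rightarrow> 'a \<Rightarrow> enat) \<Rightarrow> int \<Rightarrow> real" where
  "atom_coeff M \<phi> Ct \<nu> k =
     Ct * 2 powi k * enn2real (L_norm M \<phi> (indicator (B_set M (\<nu> k))))"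

definition atomic_decomp ::
  "'a measure \<Rightarrow> (nat \<Rightarrow> 'a measure) \<Rightarrow> ('a \<Rightarrow> real \<Rightarrow> real) \<Rightarrow> ennreal \<Rightarrow> real \<Rightarrow>
   (nat \<Rightarrow> 'a \<Rightarrow> real) \<Rightarrow> (int \<Rightarrow> 'a \<Rightarrow> real) \<Rightarrow> (int \<Rightarrow> 'a \<Rightarrow> enat) \<Rightarrow> bool" where
  "atomic_decomp M F \<phi> q Ct f a \<nu> \<longleftrightarrow>
     (\<forall>k. satom M F \<phi> q (\<nu> k) (a k)) \<and>
     (\<forall>n. AE x in M.
        ((\<lambda>k. atom_coeff M \<phi> Ct \<nu> k * real_cond_exp M (F n) (a k) x) has_sum f n x) UNIV)"

definition WHat_norm ::
  "'a measure \<Rightarrow> (nat \<Rightarrow> 'a measure) \<Rightarrow> ('a \<Rightarrow> real \<Rightarrow> real) \<Rightarrow> ennreal \<Rightarrow> real \<Rightarrow>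
   (nat \<Rightarrow> 'a \<Rightarrow> real) \<Rightarrow> ennreal" where
  "WHat_norm M F \<phi> q Ct f =
     (INF (a, \<nu>)\<in>{(a, \<nu>). atomic_decomp M F \<phi> q Ct f a \<nu>}.
        Inf (ennreal ` {l. 0 < l \<and>
          (SUP k. phi_mass M \<phi> (B_set M (\<nu> k)) (2 powi k / l)) \<le> 1}))"

definition WHat ::
  "'a measure \<Rightarrow> (nat \<Rightarrow> 'a measure) \<Rightarrow> ('a \<Rightarrow> real \<Rightarrow> real) \<Rightarrow> ennreal \<Rightarrow> real \<Rightarrow>
   (nat \<Rightarrow> 'a \<Rightarrow> real) set" where
  "WHat M F \<phi> q Ct =
     {f \<in> martingales0 M F. (\<exists>a \<nu>. atomic_decomp M F \<phi> q Ct f a \<nu>) \<and> WHat_norm M F \<phi> q Ct f < \<infinity>}"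

end

theory Submission
  imports Defs
begin

text \<open>An atomic decomposition is obtained by slicing the conditional square function dyadically.
  With \<open>Q\<^sub>n = (\<Sum>j<n. E\<^sub>j |d\<^sub>j\<^sub>+\<^sub>1 f|\<^sup>2)\<close> and \<open>\<tau>\<^sub>k = (Ct / 2) 2\<^sup>k\<close>, the \<open>k\<close>-th atom collects those
  differences \<open>d\<^sub>j\<^sub>+\<^sub>1 f\<close> for which \<open>\<tau>\<^sub>k\<^sup>2 < Q\<^sub>j\<^sub>+\<^sub>1 \<le> \<tau>\<^sub>k\<^sub>+\<^sub>1\<^sup>2\<close>. For each \<open>j\<close> exactly one \<open>k\<close> qualifies at almost
  every point where \<open>d\<^sub>j\<^sub>+\<^sub>1 f \<noteq> 0\<close>, the square function of a slice is at most \<open>\<tau>\<^sub>k\<^sub>+\<^sub>1\<close>, hence the slice is an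
  \<open>L\<^sup>2\<close>-bounded martingale and has a terminal value, and its stopping time is finite exactly on
  \<open>{s(f) > \<tau>\<^sub>k}\<close>.

  Conversely, let \<open>f\<close> be decomposed into atoms. The Cauchy--Schwarz inequality with weights
  \<open>w\<^sub>i = 2 powr (- \<delta> |i|)\<close>, centred at the dyadic level of \<open>\<alpha>\<close>, shows that \<open>s(f) > \<alpha>\<close> forces
  \<open>\<mu>\<^sup>k s(a\<^sup>k) > c w\<^sub>i \<alpha>\<close> for some \<open>k\<close>. Above the level of \<open>\<alpha>\<close> such a set lies in \<open>B\<^sub>\<nu>\<close> and its mass is
  controlled by the lower type; below it Chebyshev's inequality with an exponent larger than \<open>p_up\<close>
  and the upper type apply. The resulting bounds form a convergent geometric series.\<close>

section \<open>The conditional square function of a countable sum\<close>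

lemma ennpowr_ennreal: "0 \<le> a \<Longrightarrow> ennpowr (ennreal a) r = ennreal (a powr r)"
  by (simp add: ennpowr_def)

lemma ennpowr_le_iff:
  assumes "0 < r"
  shows "ennpowr x r \<le> ennpowr y r \<longleftrightarrow> x \<le> y"
  using assms powr_less_mono2[of r]
  by (cases x; cases y; auto simp: ennpowr_def top_unique powr_mono2 not_le[symmetric] 
        intro: powr_mono2 leI)

lemma ennpowr_le_ennreal_iff:
  assumes "0 < r" "0 \<le> a"
  shows "ennpowr x (1 / r) \<le> ennreal a \<longleftrightarrow> x \<le> ennreal (a powr r)"
proof -
  have "ennreal a = ennpowr (ennreal (a powr r)) (1 / r)"
    using assms by (simp add: ennpowr_ennreal powr_powr)
  then show ?thesis
    using assms by (simp add: ennpowr_le_iff)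
qed

lemma borel_measurable_ennpowr [measurable]:
  assumes [measurable]: "f \<in> borel_measurable M"
  shows "(\<lambda>x. ennpowr (f x) r) \<in> borel_measurable M"
  unfolding ennpowr_def by measurable

text \<open>Tonelli's theorem: one of the two sums is read as an integral over the counting measure,
  and monotone convergence interchanges it with the other.\<close>

lemma suminf_ennreal_swap:
  fixes f :: "nat \<Rightarrow> nat \<Rightarrow> ennreal"
  shows "(\<Sum>i. \<Sum>j. f i j) = (\<Sum>j. \<Sum>i. f i j)"
  using nn_integral_suminf[of f "count_space UNIV"] by (simp add: nn_integral_count_space_nat)

text \<open>Cauchy--Schwarz for partial sums after writing \<open>x i\<close> as
  \<open>sqrt (w i) * (x i / sqrt (w i))\<close>, followed by a limit. The right-hand side is an
  \<open>ennreal\<close>, so it makes sense even when the weighted squares are not summable.\<close>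

lemma weighted_Cauchy_Schwarz_sums:
  fixes x w :: "nat \<Rightarrow> real"
  assumes x: "x sums s" and w: "\<And>i. 0 < w i" "summable w"
  shows "ennreal (s\<^sup>2) \<le> ennreal (suminf w) * (\<Sum>i. ennreal ((x i)\<^sup>2 / w i))"
proof (rule LIMSEQ_le_const2)
  show "(\<lambda>n. ennreal ((\<Sum>i<n. x i)\<^sup>2)) \<longlonglongrightarrow> ennreal (s\<^sup>2)"
    using x by (intro tendsto_intros tendsto_ennrealI) (simp add: sums_def)
  have "ennreal ((\<Sum>i<n. x i)\<^sup>2) \<le> ennreal (suminf w) * (\<Sum>i. ennreal ((x i)\<^sup>2 / w i))" for n
  proof -
    have "(\<Sum>i<n. sqrt (w i) * (x i / sqrt (w i)))\<^sup>2
        \<le> (\<Sum>i<n. (sqrt (w i))\<^sup>2) * (\<Sum>i<n. (x i / sqrt (w i))\<^sup>2)"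
      by (rule Cauchy_Schwarz_ineq_sum)
    also have "(\<Sum>i<n. sqrt (w i) * (x i / sqrt (w i))) = (\<Sum>i<n. x i)"
      using w(1) by (intro sum.cong) (auto simp: less_imp_neq[symmetric])
    also have "(\<Sum>i<n. (sqrt (w i))\<^sup>2) = (\<Sum>i<n. w i)"
      using w(1) by (intro sum.cong) (auto simp: less_imp_le)
    also have "(\<Sum>i<n. (x i / sqrt (w i))\<^sup>2) = (\<Sum>i<n. (x i)\<^sup>2 / w i)"
      using w(1) by (intro sum.cong) (auto simp: less_imp_le power_divide)
    finally have "(\<Sum>i<n. x i)\<^sup>2 \<le> (\<Sum>i<n. w i) * (\<Sum>i<n. (x i)\<^sup>2 / w i)" .
    also have "\<dots> \<le> suminf w * (\<Sum>i<n. (x i)\<^sup>2 / w i)"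
      using w by (intro mult_right_mono sum_le_suminf sum_nonneg) (auto simp: less_imp_le)
    finally have "ennreal ((\<Sum>i<n. x i)\<^sup>2) \<le> ennreal (suminf w * (\<Sum>i<n. (x i)\<^sup>2 / w i))"
      by (rule ennreal_leI)
    also have "\<dots> = ennreal (suminf w) * (\<Sum>i<n. ennreal ((x i)\<^sup>2 / w i))"
      using w by (subst ennreal_mult)
        (auto intro!: suminf_nonneg sum_nonneg simp: less_imp_le sum_ennreal)
    also have "\<dots> \<le> ennreal (suminf w) * (\<Sum>i. ennreal ((x i)\<^sup>2 / w i))"
      by (intro mult_left_mono sum_le_suminf) auto
    finally show ?thesis .
  qed
  then show "\<exists>N. \<forall>n\<ge>N. ennreal ((\<Sum>i<n. x i)\<^sup>2) \<le> ennreal (suminf w) * (\<Sum>i. ennreal ((x i)\<^sup>2 / w i))"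
    by blast
qed

text \<open>Both sides have the same integral over every set of \<open>F\<close>: monotone
  convergence is used once for the \<open>g i\<close> and once for their conditional
  expectations.\<close>

lemma (in sigma_finite_subalgebra) nn_cond_exp_suminf:
  assumes [measurable]: "\<And>i::nat. g i \<in> borel_measurable M"
  shows "AE x in M. (\<Sum>i. nn_cond_exp M F (g i) x) = nn_cond_exp M F (\<lambda>x. \<Sum>i. g i x) x"
proof (rule nn_cond_exp_charact)
  fix A assume A [measurable]: "A \<in> sets F"
  have [measurable]: "A \<in> sets M"
    using A subalg by (auto simp: subalgebra_def)
  have *: "nn_cond_exp M F h \<in> borel_measurable M" for h
    by (rule borel_measurable_nn_cond_exp2)
  have "(\<integral>\<^sup>+x\<in>A. (\<Sum>i. g i x) \<partial>M) = (\<integral>\<^sup>+x. (\<Sum>i. indicator A x * g i x) \<partial>M)"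
    by (simp add: mult.commute)
  also have "\<dots> = (\<Sum>i. \<integral>\<^sup>+x. indicator A x * g i x \<partial>M)"
    by (rule nn_integral_suminf) measurable
  also have "\<dots> = (\<Sum>i. \<integral>\<^sup>+x. indicator A x * nn_cond_exp M F (g i) x \<partial>M)"
    by (subst nn_cond_exp_intg) auto
  also have "\<dots> = (\<integral>\<^sup>+x. (\<Sum>i. indicator A x * nn_cond_exp M F (g i) x) \<partial>M)"
    using * by (intro nn_integral_suminf[symmetric]) measurable
  also have "\<dots> = (\<integral>\<^sup>+x\<in>A. (\<Sum>i. nn_cond_exp M F (g i) x) \<partial>M)"
    by (simp add: mult.commute)
  finally show "(\<integral>\<^sup>+x\<in>A. (\<Sum>i. g i x) \<partial>M) = (\<integral>\<^sup>+x\<in>A. (\<Sum>i. nn_cond_exp M F (g i) x) \<partial>M)" .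
qed auto

text \<open>The summand E_j |d_(j+1) f|^2 of s(f)^2. It is measurable with respect to F_j already,
  and this predictability drives the choice of stopping times.\<close>

definition cond_var ::
  "'a measure \<Rightarrow> (nat \<Rightarrow> 'a measure) \<Rightarrow> (nat \<Rightarrow> 'a \<Rightarrow> real) \<Rightarrow> nat \<Rightarrow> 'a \<Rightarrow> ennreal" where
  "cond_var M F f j = nn_cond_exp M (F j) (\<lambda>y. ennreal ((mdiff f (Suc j) y)\<^sup>2))"

lemma cond_square_eq: "cond_square M F f x = ennpowr (\<Sum>j. cond_var M F f j x) (1/2)"
  by (simp add: cond_square_def cond_var_def)

lemma cond_square_le_iff:
  assumes "0 \<le> a"
  shows "cond_square M F f x \<le> ennreal a \<longleftrightarrow> (\<Sum>j. cond_var M F f j x) \<le> ennreal (a\<^sup>2)"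
  using assms ennpowr_le_ennreal_iff[of 2 a] by (cases "a = 0") (auto simp: cond_square_eq powr_numeral)

lemma mult_cond_square_le:
  assumes "0 \<le> b" "0 \<le> c" "ennreal c * cond_square M F f x \<le> ennreal b"
  shows "ennreal (c\<^sup>2) * (\<Sum>j. cond_var M F f j x) \<le> ennreal (b\<^sup>2)"
\<comment> \<open>For \<open>c = 0\<close> the left-hand side is 0 even where the sum is infinite;
  otherwise \<open>c\<close> can be divided out.\<close>
proof (cases "c = 0")
  case False
  then have c: "0 < c" using assms by simp
  have "cond_square M F f x = ennreal (1 / c) * (ennreal c * cond_square M F f x)"
    using c by (simp add: mult.assoc[symmetric] ennreal_mult[symmetric])
  also have "\<dots> \<le> ennreal (1 / c) * ennreal b"
    using assms by (intro mult_left_mono) auto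
  also have "\<dots> = ennreal (b / c)"
    using c assms by (simp add: ennreal_mult[symmetric])
  finally have "(\<Sum>j. cond_var M F f j x) \<le> ennreal ((b / c)\<^sup>2)"
    using c assms by (subst (asm) cond_square_le_iff) auto
  then have "ennreal (c\<^sup>2) * (\<Sum>j. cond_var M F f j x) \<le> ennreal (c\<^sup>2) * ennreal ((b / c)\<^sup>2)"
    by (intro mult_left_mono) auto
  also have "\<dots> = ennreal (b\<^sup>2)"
    using c by (simp add: ennreal_mult[symmetric] power_divide)
  finally show ?thesis .
qed simp

locale filtered_prob_space = prob_space M for M :: "'a measure" +
  fixes F :: "nat \<Rightarrow> 'a measure"
  assumes filtration_F: "filtration (space M) F"
    and subalgebra_F: "\<And>n. subalgebra M (F n)"
begin

sublocale F: finite_measure_subalgebra M "F n" for n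
  by unfold_locales (rule subalgebra_F)

lemma measurable_F_M: "f \<in> borel_measurable (F n) \<Longrightarrow> f \<in> borel_measurable M"
  using measurable_from_subalg[OF subalgebra_F] by blast

lemma measurable_F_mono:
  assumes "f \<in> measurable (F m) N" "m \<le> n"
  shows "f \<in> measurable (F n) N"
  using assms filtration.sets_F_mono[OF filtration_F, of m n] filtration.space_F[OF filtration_F]
  by (auto simp: measurable_def)

lemma measurable_cond_var_F [measurable]: "cond_var M F f j \<in> borel_measurable (F j)"
  unfolding cond_var_def by measurable

lemma measurable_cond_var [measurable]: "cond_var M F f j \<in> borel_measurable M"
  unfolding cond_var_def by (rule borel_measurable_nn_cond_exp2)

lemma measurable_cond_square [measurable]: "cond_square M F f \<in> borel_measurable M"
  unfolding cond_square_eq[abs_def] by measurable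

lemma cond_var_cmult:
  assumes [measurable]: "\<And>n. f n \<in> borel_measurable M"
  shows "AE x in M. nn_cond_exp M (F j) (\<lambda>x. ennreal c * ennreal ((mdiff f (Suc j) x)\<^sup>2)) x
    = ennreal c * cond_var M F f j x"
proof -
  have [measurable]: "(\<lambda>x. mdiff f (Suc j) x) \<in> borel_measurable M"
    unfolding mdiff_def by measurable
  have "AE x in M. ennreal c * nn_cond_exp M (F j) (\<lambda>x. ennreal ((mdiff f (Suc j) x)\<^sup>2)) x
    = nn_cond_exp M (F j) (\<lambda>x. ennreal c * ennreal ((mdiff f (Suc j) x)\<^sup>2)) x"
    by (rule F.nn_cond_exp_prod) measurable
  then show ?thesis
    by (auto simp: cond_var_def)
qed

text \<open>Deterministic weights reduce the sublinearity of the conditional square function to the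
  countable additivity of conditional expectations, so that no conditional Minkowski inequality
  is required.\<close>

lemma cond_square_decomp:
  fixes a :: "nat \<Rightarrow> nat \<Rightarrow> 'a \<Rightarrow> real" and w c :: "nat \<Rightarrow> real"
  assumes meas [measurable]: "\<And>n. f n \<in> borel_measurable M" "\<And>i n. a i n \<in> borel_measurable M"
    and sums: "\<And>n. AE x in M. (\<lambda>i. c i * a i n x) sums f n x"
    and c: "\<And>i. 0 \<le> c i"
    and w: "\<And>i. 0 < w i" "summable w"
  shows "AE x in M. \<forall>\<alpha>>0. ennreal \<alpha> < cond_square M F f x \<longrightarrow>
    (\<exists>i. ennreal (\<alpha> * w i / suminf w) < ennreal (c i) * cond_square M F (a i) x)"
proof -
  define W where "W = suminf w"
  have W: "0 < W"
    unfolding W_def using w by (intro suminf_pos) auto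
  have md [measurable]: "(\<lambda>x. mdiff f n x) \<in> borel_measurable M"
      "(\<lambda>x. mdiff (a i) n x) \<in> borel_measurable M" for i n
    unfolding mdiff_def by measurable
  \<comment> \<open>Cauchy--Schwarz is applied to the difference d_(j+1) f; E_j then passes through
    the countable sum and the deterministic factors.\<close>
  have step: "AE x in M. cond_var M F f j x
      \<le> ennreal W * (\<Sum>i. ennreal ((c i)\<^sup>2 / w i) * cond_var M F (a i) j x)" for j
  proof -
    let ?g = "\<lambda>i x. ennreal ((c i)\<^sup>2 / w i) * ennreal ((mdiff (a i) (Suc j) x)\<^sup>2)"
    have "AE x in M. ennreal ((mdiff f (Suc j) x)\<^sup>2) \<le> ennreal W * (\<Sum>i. ?g i x)"
      using sums[of "Suc j"] sums[of j]
    proof eventually_elim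
      case (elim x)
      have "(\<lambda>i. c i * mdiff (a i) (Suc j) x) sums mdiff f (Suc j) x"
        using sums_diff[OF elim] by (simp add: mdiff_def right_diff_distrib)
      from weighted_Cauchy_Schwarz_sums[OF this w]
      have "ennreal ((mdiff f (Suc j) x)\<^sup>2)
          \<le> ennreal W * (\<Sum>i. ennreal ((c i * mdiff (a i) (Suc j) x)\<^sup>2 / w i))"
        by (simp add: W_def)
      also have "(\<lambda>i. ennreal ((c i * mdiff (a i) (Suc j) x)\<^sup>2 / w i)) = (\<lambda>i. ?g i x)"
        using w(1) by (auto simp: ennreal_mult[symmetric] power_mult_distrib less_imp_le)
      finally show ?case .
    qed
    then have 1: "AE x in M. cond_var M F f j x
        \<le> nn_cond_exp M (F j) (\<lambda>x. ennreal W * (\<Sum>i. ?g i x)) x"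
      unfolding cond_var_def by (intro F.nn_cond_exp_mono) measurable
    have 2: "AE x in M. ennreal W * nn_cond_exp M (F j) (\<lambda>x. \<Sum>i. ?g i x) x
        = nn_cond_exp M (F j) (\<lambda>x. ennreal W * (\<Sum>i. ?g i x)) x"
      by (rule F.nn_cond_exp_prod) measurable
    have 3: "AE x in M. (\<Sum>i. nn_cond_exp M (F j) (?g i) x)
        = nn_cond_exp M (F j) (\<lambda>x. \<Sum>i. ?g i x) x"
      by (rule F.nn_cond_exp_suminf) measurable
    have 4: "AE x in M. \<forall>i. nn_cond_exp M (F j) (?g i) x
        = ennreal ((c i)\<^sup>2 / w i) * cond_var M F (a i) j x"
      by (intro AE_all_countable[THEN iffD2] allI cond_var_cmult) measurable
    from 1 2 3 4 show ?thesis
      by eventually_elim simp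
  qed
  then have "AE x in M. \<forall>j. cond_var M F f j x
      \<le> ennreal W * (\<Sum>i. ennreal ((c i)\<^sup>2 / w i) * cond_var M F (a i) j x)"
    by (intro AE_all_countable[THEN iffD2] allI)
  then show ?thesis
  proof eventually_elim
    case (elim x)
    show ?case
    \<comment> \<open>The exceptional null set does not depend on \<alpha>. If no term exceeds its
      share \<open>\<alpha> * w i / W\<close>, summing over \<open>j\<close> first bounds s(f)^2 by
      W times the sum of (1 / w_i) (\<alpha> w_i / W)^2, which is \<alpha>^2 because the weights sum
      to W.\<close>
    proof (intro allI impI, rule ccontr)
      fix \<alpha> :: real assume \<alpha>: "0 < \<alpha>" and gt: "ennreal \<alpha> < cond_square M F f x"
      assume "\<not> (\<exists>i. ennreal (\<alpha> * w i / suminf w) < ennreal (c i) * cond_square M F (a i) x)"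
      then have le: "ennreal (c i) * cond_square M F (a i) x \<le> ennreal (\<alpha> * w i / W)" for i
        by (simp add: not_less W_def)
      have le': "ennreal ((c i)\<^sup>2) * (\<Sum>j. cond_var M F (a i) j x) \<le> ennreal ((\<alpha> * w i / W)\<^sup>2)" for i
        using \<alpha> W w(1)[of i] c le by (intro mult_cond_square_le) auto
      have "(\<Sum>j. cond_var M F f j x)
          \<le> (\<Sum>j. ennreal W * (\<Sum>i. ennreal ((c i)\<^sup>2 / w i) * cond_var M F (a i) j x))"
        using elim by (intro suminf_le) auto
      also have "\<dots> = ennreal W * (\<Sum>i. ennreal ((c i)\<^sup>2 / w i) * (\<Sum>j. cond_var M F (a i) j x))"
        by (simp add: ennreal_suminf_cmult suminf_ennreal_swap[of "\<lambda>j i. _ i * _ i j"])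
      also have "\<dots> = ennreal W * (\<Sum>i. ennreal (1 / w i) * (ennreal ((c i)\<^sup>2) * (\<Sum>j. cond_var M F (a i) j x)))"
        using w(1) by (simp add: ennreal_mult[symmetric] mult.assoc[symmetric] less_imp_le)
      also have "\<dots> \<le> ennreal W * (\<Sum>i. ennreal (1 / w i) * ennreal ((\<alpha> * w i / W)\<^sup>2))"
        by (intro mult_left_mono suminf_le le') auto
      also have "(\<lambda>i. ennreal (1 / w i) * ennreal ((\<alpha> * w i / W)\<^sup>2)) = (\<lambda>i. ennreal ((\<alpha> / W)\<^sup>2 * w i))"
      proof
        fix i
        have "1 / w i * (\<alpha> * w i / W)\<^sup>2 = (\<alpha> / W)\<^sup>2 * w i"
          using w(1)[of i] by (simp add: power2_eq_square)
        then show "ennreal (1 / w i) * ennreal ((\<alpha> * w i / W)\<^sup>2) = ennreal ((\<alpha> / W)\<^sup>2 * w i)"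
          using w(1)[of i] by (simp add: ennreal_mult[symmetric] less_imp_le)
      qed
      also have "(\<Sum>i. ennreal ((\<alpha> / W)\<^sup>2 * w i)) = ennreal ((\<alpha> / W)\<^sup>2 * W)"
        using w by (subst suminf_ennreal_eq[where x="(\<alpha> / W)\<^sup>2 * W"])
          (auto simp: W_def less_imp_le intro!: sums_mult summable_sums)
      also have "ennreal W * \<dots> = ennreal (\<alpha>\<^sup>2)"
        using W by (simp add: ennreal_mult[symmetric] power2_eq_square)
      finally have "cond_square M F f x \<le> ennreal \<alpha>"
        using \<alpha> by (simp add: cond_square_le_iff)
      with gt show False by simp
    qed
  qed
qed

end

section \<open>Masses of sets under a Musielak--Orlicz function\<close>

locale musielak_orlicz_prob = prob_space M for M :: "'a measure" +
  fixes \<phi> :: "'a \<Rightarrow> real \<Rightarrow> real" and p_lo p_up :: real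
  assumes mo: "musielak_orlicz M \<phi>"
    and nn_integral_phi_finite: "\<And>t. t > 0 \<Longrightarrow> (\<integral>\<^sup>+x. ennreal (\<phi> x t) \<partial>M) < \<infinity>"
    and p_lo: "p_lo > 0" and lower: "uniformly_lower_type M \<phi> p_lo"
    and p_up: "p_up > 0" and upper: "uniformly_upper_type M \<phi> p_up"
begin

lemma measurable_phi: "0 \<le> t \<Longrightarrow> (\<lambda>x. \<phi> x t) \<in> borel_measurable M"
  using mo by (auto simp: musielak_orlicz_def)

lemma phi_zero: "x \<in> space M \<Longrightarrow> \<phi> x 0 = 0"
  and phi_pos: "x \<in> space M \<Longrightarrow> 0 < t \<Longrightarrow> 0 < \<phi> x t"
  using mo by (auto simp: musielak_orlicz_def)

lemma phi_nonneg: "x \<in> space M \<Longrightarrow> 0 \<le> t \<Longrightarrow> 0 \<le> \<phi> x t"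
  using phi_zero phi_pos by (cases "t = 0") (auto simp: less_imp_le)

lemma phi_mass_mono_AE:
  assumes "AE x in M. x \<in> A \<longrightarrow> x \<in> B"
  shows "phi_mass M \<phi> A t \<le> phi_mass M \<phi> B t"
  unfolding phi_mass_def using assms
  by (intro nn_integral_mono_AE) (auto elim!: eventually_mono split: split_indicator)

lemma phi_mass_le_suminf:
  fixes E :: "nat \<Rightarrow> 'a set"
  assumes "0 \<le> t" and [measurable]: "\<And>i. E i \<in> sets M"
    and "AE x in M. x \<in> A \<longrightarrow> (\<exists>i. x \<in> E i)"
  shows "phi_mass M \<phi> A t \<le> (\<Sum>i. phi_mass M \<phi> (E i) t)"
proof -
  note [measurable] = measurable_phi[OF \<open>0 \<le> t\<close>]
  have "phi_mass M \<phi> A t \<le> (\<integral>\<^sup>+x. (\<Sum>i. ennreal (\<phi> x t) * indicator (E i) x) \<partial>M)"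
    unfolding phi_mass_def using assms(3)
  proof (intro nn_integral_mono_AE, eventually_elim)
    case (elim x)
    show ?case
    proof (cases "x \<in> A")
      case True
      then obtain i where "x \<in> E i" using elim by blast
      then have "ennreal (\<phi> x t) * indicator A x \<le> (\<Sum>i\<in>{i}. ennreal (\<phi> x t) * indicator (E i) x)"
        by (simp split: split_indicator)
      also have "\<dots> \<le> (\<Sum>i. ennreal (\<phi> x t) * indicator (E i) x)"
        by (intro sum_le_suminf) auto
      finally show ?thesis .
    qed simp
  qed
  also have "\<dots> = (\<Sum>i. phi_mass M \<phi> (E i) t)"
    unfolding phi_mass_def by (rule nn_integral_suminf) measurable
  finally show ?thesis .
qed

lemma phi_mass_finite:
  assumes "0 < t"
  shows "phi_mass M \<phi> E t < \<infinity>"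
proof -
  have "phi_mass M \<phi> E t \<le> (\<integral>\<^sup>+x. ennreal (\<phi> x t) \<partial>M)"
    unfolding phi_mass_def by (intro nn_integral_mono) (simp split: split_indicator)
  with nn_integral_phi_finite[OF assms] show ?thesis by simp
qed

text \<open>Since \<open>\<phi> x t\<close> is strictly positive for t > 0, the measure with this
  density has the same null sets as \<open>M\<close>.\<close>

lemma phi_mass_eq_0_iff:
  assumes "0 < t" and [measurable]: "E \<in> sets M"
  shows "phi_mass M \<phi> E t = 0 \<longleftrightarrow> emeasure M E = 0"
proof -
  have [measurable]: "(\<lambda>x. \<phi> x t) \<in> borel_measurable M"
    using assms by (simp add: measurable_phi)
  have "phi_mass M \<phi> E t = 0 \<longleftrightarrow> (AE x in M. ennreal (\<phi> x t) * indicator E x = 0)"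
    unfolding phi_mass_def by (rule nn_integral_0_iff_AE) measurable
  also have "\<dots> \<longleftrightarrow> (AE x in M. x \<notin> E)"
    using phi_pos[OF _ \<open>0 < t\<close>] by (intro AE_cong) (force split: split_indicator)
  also have "\<dots> \<longleftrightarrow> emeasure M E = 0"
    using sets.sets_into_space[OF assms(2)] by (subst AE_iff_measurable[of E]) auto
  finally show ?thesis .
qed

lemma phi_mass_scale_le:
  assumes "0 < t" "0 \<le> D" and E [measurable]: "E \<in> sets M"
    and le: "\<And>x. x \<in> space M \<Longrightarrow> \<phi> x u \<le> D * \<phi> x t"
  shows "phi_mass M \<phi> E u \<le> ennreal D * phi_mass M \<phi> E t"
proof -
  have [measurable]: "(\<lambda>x. \<phi> x t) \<in> borel_measurable M"
    using assms by (simp add: measurable_phi)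
  have "phi_mass M \<phi> E u \<le> (\<integral>\<^sup>+x. ennreal D * (ennreal (\<phi> x t) * indicator E x) \<partial>M)"
    unfolding phi_mass_def
  proof (rule nn_integral_mono)
    fix x assume x: "x \<in> space M"
    have "ennreal (\<phi> x u) \<le> ennreal D * ennreal (\<phi> x t)"
      using le[OF x] assms(1,2) x by (simp add: ennreal_mult[symmetric] phi_nonneg ennreal_leI)
    then show "ennreal (\<phi> x u) * indicator E x \<le> ennreal D * (ennreal (\<phi> x t) * indicator E x)"
      by (simp split: split_indicator)
  qed
  also have "\<dots> = ennreal D * phi_mass M \<phi> E t"
    unfolding phi_mass_def by (rule nn_integral_cmult) measurable
  finally show ?thesis .
qed

text \<open>The pointwise type inequalities are integrated over \<open>E\<close>. One constant
  serves both, and \<open>1 \<le> C\<close> also admits s = 1 in the lower estimate, a value that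
  the definition of lower type leaves out.\<close>

lemma phi_mass_types:
  obtains C where "1 \<le> C"
    "\<And>E s t. E \<in> sets M \<Longrightarrow> 0 < t \<Longrightarrow> 0 < s \<Longrightarrow> s \<le> 1 \<Longrightarrow>
      phi_mass M \<phi> E (s * t) \<le> ennreal (C * s powr p_lo) * phi_mass M \<phi> E t"
    "\<And>E s t. E \<in> sets M \<Longrightarrow> 0 < t \<Longrightarrow> 1 \<le> s \<Longrightarrow>
      phi_mass M \<phi> E (s * t) \<le> ennreal (C * s powr p_up) * phi_mass M \<phi> E t"
proof -
  obtain A where A: "A > 0" "\<And>x s t. x \<in> space M \<Longrightarrow> t \<ge> 0 \<Longrightarrow> s \<in> {0<..<1} \<Longrightarrow>
      \<phi> x (s * t) \<le> A * s powr p_lo * \<phi> x t"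
    using lower unfolding uniformly_lower_type_def by blast
  obtain B where B: "B > 0" "\<And>x s t. x \<in> space M \<Longrightarrow> t \<ge> 0 \<Longrightarrow> s \<ge> 1 \<Longrightarrow>
      \<phi> x (s * t) \<le> B * s powr p_up * \<phi> x t"
    using upper unfolding uniformly_upper_type_def by blast
  define C where "C = max 1 (max A B)"
  show thesis
  proof (rule that[of C])
    show "1 \<le> C" by (simp add: C_def)
    fix E and s t :: real assume E: "E \<in> sets M" and t: "0 < t"
    {
      assume s: "0 < s" "s \<le> 1"
      show "phi_mass M \<phi> E (s * t) \<le> ennreal (C * s powr p_lo) * phi_mass M \<phi> E t"
      proof (rule phi_mass_scale_le[OF t _ E])
        fix x assume x: "x \<in> space M"
        note nn = phi_nonneg[OF x less_imp_le[OF t]]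
        show "\<phi> x (s * t) \<le> C * s powr p_lo * \<phi> x t"
        proof (cases "s = 1")
          case True
          have "1 * \<phi> x t \<le> C * \<phi> x t"
            using nn by (intro mult_right_mono) (auto simp: C_def)
          with True show ?thesis by simp
        next
          case False
          then have "\<phi> x (s * t) \<le> A * s powr p_lo * \<phi> x t"
            using A(2)[OF x, of t s] s t by auto
          also have "\<dots> \<le> C * s powr p_lo * \<phi> x t"
            using nn by (intro mult_right_mono) (auto simp: C_def)
          finally show ?thesis .
        qed
      qed (simp add: C_def)
    next
      assume s: "1 \<le> s"
      show "phi_mass M \<phi> E (s * t) \<le> ennreal (C * s powr p_up) * phi_mass M \<phi> E t"
      proof (rule phi_mass_scale_le[OF t _ E])
        fix x assume x: "x \<in> space M"
        have "\<phi> x (s * t) \<le> B * s powr p_up * \<phi> x t"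
          using B(2)[OF x, of t s] s t by auto
        also have "\<dots> \<le> C * s powr p_up * \<phi> x t"
          using phi_nonneg[OF x less_imp_le[OF t]]
          by (intro mult_right_mono) (auto simp: C_def)
        finally show "\<phi> x (s * t) \<le> C * s powr p_up * \<phi> x t" .
      qed (simp add: C_def)
    }
  qed
qed

text \<open>Lets a bound K on masses be absorbed into a quasi-norm. By the lower type the mass at t
  / N is at most C K N^(-p_lo), which is at most 1 as soon as N^p_lo >= C K.\<close>

lemma phi_mass_rescale:
  assumes "0 \<le> K"
  obtains N where "1 \<le> N"
    "\<And>E t. E \<in> sets M \<Longrightarrow> 0 < t \<Longrightarrow> phi_mass M \<phi> E t \<le> ennreal K \<Longrightarrow> phi_mass M \<phi> E (t / N) \<le> 1"
proof -
  obtain C where C: "1 \<le> C" "\<And>E s t. E \<in> sets M \<Longrightarrow> 0 < t \<Longrightarrow> 0 < s \<Longrightarrow> s \<le> 1 \<Longrightarrow>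
      phi_mass M \<phi> E (s * t) \<le> ennreal (C * s powr p_lo) * phi_mass M \<phi> E t"
    using phi_mass_types by metis
  define N where "N = max 1 ((C * K) powr (1 / p_lo))"
  have N: "1 \<le> N" by (simp add: N_def)
  have "C * K = ((C * K) powr (1 / p_lo)) powr p_lo"
    using assms C(1) p_lo by (simp add: powr_powr)
  also have "\<dots> \<le> N powr p_lo"
    using p_lo by (intro powr_mono2) (auto simp: N_def)
  finally have CK: "C * K \<le> N powr p_lo" .
  show thesis
  proof (rule that[OF N])
    fix E t assume E: "E \<in> sets M" "0 < t" "phi_mass M \<phi> E t \<le> ennreal K"
    have "phi_mass M \<phi> E (t / N) \<le> ennreal (C * (1 / N) powr p_lo) * phi_mass M \<phi> E t"
      using C(2)[OF E(1,2), of "1 / N"] N by simp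
    also have "\<dots> \<le> ennreal (C * (1 / N) powr p_lo) * ennreal K"
      by (intro mult_left_mono E) simp
    also have "\<dots> = ennreal (C * K / N powr p_lo)"
      using N C(1) assms by (subst ennreal_mult[symmetric]) (auto simp: powr_divide)
    also have "\<dots> \<le> 1"
      using CK N by (intro ennreal_le_1[THEN iffD2]) (simp add: divide_le_eq)
    finally show "phi_mass M \<phi> E (t / N) \<le> 1" .
  qed
qed

text \<open>The lower type with s = 1 / t compares the levels 1 and t > 1: the positive mass m at
  level 1 is at most C t^(-p_lo) times the mass at level t. Mass at most 1 therefore forces t^p_lo
  <= C / m.\<close>

lemma phi_mass_le_1_bounded:
  assumes E: "E \<in> sets M" "emeasure M E \<noteq> 0"
  obtains T where "0 < T" "\<And>t. 0 < t \<Longrightarrow> phi_mass M \<phi> E t \<le> 1 \<Longrightarrow> t \<le> T"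
proof -
  obtain C where C: "1 \<le> C" "\<And>E s t. E \<in> sets M \<Longrightarrow> 0 < t \<Longrightarrow> 0 < s \<Longrightarrow> s \<le> 1 \<Longrightarrow>
      phi_mass M \<phi> E (s * t) \<le> ennreal (C * s powr p_lo) * phi_mass M \<phi> E t"
    using phi_mass_types by metis
  define m where "m = enn2real (phi_mass M \<phi> E 1)"
  have m_eq: "phi_mass M \<phi> E 1 = ennreal m"
    using phi_mass_finite[of 1 E] by (simp add: m_def)
  have "m \<noteq> 0"
    using phi_mass_eq_0_iff[of 1 E] E m_eq by auto
  then have m: "phi_mass M \<phi> E 1 = ennreal m" "0 < m"
    using m_eq enn2real_nonneg[of "phi_mass M \<phi> E 1"] unfolding m_def[symmetric] by auto
  define T where "T = max 1 ((C / m) powr (1 / p_lo))"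
  show thesis
  proof (rule that[of T])
    show "0 < T" by (simp add: T_def)
    fix t :: real assume t: "0 < t" "phi_mass M \<phi> E t \<le> 1"
    show "t \<le> T"
    proof (cases "t \<le> 1")
      case False
      then have "phi_mass M \<phi> E (1 / t * t) \<le> ennreal (C * (1 / t) powr p_lo) * phi_mass M \<phi> E t"
        by (intro C(2)[OF E(1)]) auto
      also have "\<dots> \<le> ennreal (C * (1 / t) powr p_lo) * 1"
        by (intro mult_left_mono t) simp
      finally have "m \<le> C * (1 / t) powr p_lo"
        using t m C(1) by simp
      then have "t powr p_lo \<le> C / m"
        using t m by (simp add: powr_divide field_simps)
      then have "(t powr p_lo) powr (1 / p_lo) \<le> (C / m) powr (1 / p_lo)"
        using p_lo by (intro powr_mono2) auto
      then show ?thesis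
        using t p_lo by (simp add: powr_powr T_def)
    qed (simp add: T_def)
  qed
qed

section \<open>Luxemburg norms of indicator functions\<close>

lemma L_norm_indicator:
  "L_norm M \<phi> (indicator B) = Inf (ennreal ` {l. 0 < l \<and> phi_mass M \<phi> B (1 / l) \<le> 1})"
proof -
  have "(\<integral>\<^sup>+x. ennreal (\<phi> x (\<bar>indicator B x\<bar> / l)) \<partial>M) = phi_mass M \<phi> B (1 / l)" for l
    unfolding phi_mass_def by (intro nn_integral_cong) (simp add: phi_zero split: split_indicator)
  then show ?thesis by (simp add: L_norm_def)
qed

lemma L_norm_indicator_finite:
  assumes "B \<in> sets M"
  shows "L_norm M \<phi> (indicator B) < \<infinity>"
proof -
  obtain N where N: "1 \<le> N" "\<And>E t. E \<in> sets M \<Longrightarrow> 0 < t \<Longrightarrow>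
      phi_mass M \<phi> E t \<le> ennreal (enn2real (phi_mass M \<phi> B 1)) \<Longrightarrow> phi_mass M \<phi> E (t / N) \<le> 1"
    using phi_mass_rescale[OF enn2real_nonneg] by metis
  have "phi_mass M \<phi> B (1 / N) \<le> 1"
    using assms phi_mass_finite[of 1 B] by (intro N(2)) auto
  then have "L_norm M \<phi> (indicator B) \<le> ennreal N"
    unfolding L_norm_indicator using N(1) by (intro Inf_lower imageI) auto
  then show ?thesis by (rule le_less_trans) simp
qed

lemma L_norm_indicator_null:
  assumes "B \<in> sets M" "emeasure M B = 0"
  shows "L_norm M \<phi> (indicator B) = 0"
proof -
  have "L_norm M \<phi> (indicator B) \<le> 0 + ennreal e" if "0 < e" for e
    unfolding L_norm_indicator add_0 using that assms phi_mass_eq_0_iff[of "1 / e" B]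
    by (intro Inf_lower imageI) simp
  then have "L_norm M \<phi> (indicator B) \<le> 0"
    by (rule ennreal_le_epsilon)
  then show ?thesis by simp
qed

text \<open>An admissible l satisfies 1 / l <= T with the bound of
  \<open>phi_mass_le_1_bounded\<close>, so the infimum is at least 1 / T.\<close>

lemma L_norm_indicator_pos:
  assumes "B \<in> sets M" "emeasure M B \<noteq> 0"
  shows "0 < L_norm M \<phi> (indicator B)"
proof -
  obtain T where T: "0 < T" "\<And>t. 0 < t \<Longrightarrow> phi_mass M \<phi> B t \<le> 1 \<Longrightarrow> t \<le> T"
    using phi_mass_le_1_bounded[OF assms] by metis
  have "ennreal (1 / T) \<le> L_norm M \<phi> (indicator B)"
    unfolding L_norm_indicator
  proof (rule Inf_greatest, clarify)
    fix l :: real assume "0 < l" "phi_mass M \<phi> B (1 / l) \<le> 1"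
    with T(2)[of "1 / l"] T(1) show "ennreal (1 / T) \<le> ennreal l"
      by (intro ennreal_leI) (simp add: field_simps)
  qed
  moreover have "0 < ennreal (1 / T)" using T by simp
  ultimately show ?thesis by (rule less_le_trans[rotated])
qed

lemma L_norm_indicator_real:
  assumes "B \<in> sets M" "emeasure M B \<noteq> 0"
  obtains L where "0 < L" "L_norm M \<phi> (indicator B) = ennreal L"
    "inverse (L_norm M \<phi> (indicator B)) = ennreal (1 / L)"
  using L_norm_indicator_pos[OF assms] L_norm_indicator_finite[OF assms(1)]
  by (cases "L_norm M \<phi> (indicator B)") (auto simp: inverse_ennreal inverse_eq_divide)

end

section \<open>Tails of atoms\<close>

locale musielak_orlicz_martingales =
  filtered_prob_space M F + musielak_orlicz_prob M \<phi> p_lo p_up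
  for M :: "'a measure" and F :: "nat \<Rightarrow> 'a measure"
    and \<phi> :: "'a \<Rightarrow> real \<Rightarrow> real" and p_lo p_up :: real
begin

lemma ext_stopping_time_le_measurable:
  assumes "ext_stopping_time F \<nu>"
  shows "Measurable.pred (F n) (\<lambda>x. \<nu> x \<le> enat n)"
  using assms by (simp add: ext_stopping_time_def)

lemma B_set_in_sets [measurable]:
  assumes "ext_stopping_time F \<nu>"
  shows "B_set M \<nu> \<in> sets M"
proof -
  have fin: "\<nu> x < \<infinity> \<longleftrightarrow> (\<exists>n. \<nu> x \<le> enat n)" for x
    by (cases "\<nu> x") auto
  have "B_set M \<nu> = (\<Union>n. {x\<in>space M. \<nu> x \<le> enat n})"
    using fin by (auto simp: B_set_def)
  moreover have "{x\<in>space M. \<nu> x \<le> enat n} \<in> sets M" for n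
    using ext_stopping_time_le_measurable[OF assms, of n] subalgebra_F[of n]
    by (auto simp: subalgebra_def pred_def)
  ultimately show ?thesis by auto
qed

text \<open>For each j both a_j and a_(j+1) vanish on {\<nu> > j}. This event belongs to F_j, so its
  indicator can be pulled out of E_j, and the j-th summand of s(a)^2 vanishes there. Where \<nu> is
  infinite this applies to every j.\<close>

lemma satom_cond_square_zero:
  assumes "satom M F \<phi> q \<nu> a"
  shows "AE x in M. \<nu> x = \<infinity> \<longrightarrow> cond_square M F (\<lambda>n. real_cond_exp M (F n) a) x = 0"
proof -
  let ?a = "\<lambda>n. real_cond_exp M (F n) a"
  have st: "ext_stopping_time F \<nu>"
    and zero: "AE x in M. enat n \<le> \<nu> x \<longrightarrow> ?a n x = 0" for n
    using assms by (auto simp: satom_def)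
  have [measurable]: "?a n \<in> borel_measurable M" for n
    by (rule borel_measurable_cond_exp2)
  have [measurable]: "mdiff ?a n \<in> borel_measurable M" for n
    unfolding mdiff_def by measurable
  have "AE x in M. enat j < \<nu> x \<longrightarrow> cond_var M F ?a j x = 0" for j
  proof -
    let ?i = "indicator {x\<in>space M. \<not> \<nu> x \<le> enat j} :: 'a \<Rightarrow> ennreal"
    have "{x\<in>space M. \<not> \<nu> x \<le> enat j} \<in> sets (F j)"
      using ext_stopping_time_le_measurable[OF st, of j] subalgebra_F[of j]
        sets.sets_Collect_neg[of "F j" "\<lambda>x. \<nu> x \<le> enat j"]
      unfolding subalgebra_def by (simp add: pred_def)
    then have [measurable]: "?i \<in> borel_measurable (F j)" by simp
    have [measurable]: "?i \<in> borel_measurable M"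
      by (rule measurable_F_M) measurable
    have "AE x in M. ?i x * ennreal ((mdiff ?a (Suc j) x)\<^sup>2) = 0"
      using zero[of j] zero[of "Suc j"]
    proof eventually_elim
      case (elim x)
      show ?case
      proof (cases "enat j < \<nu> x")
        case True
        then have "enat (Suc j) \<le> \<nu> x" by (simp add: Suc_ile_eq)
        with elim True show ?thesis by (simp add: mdiff_def)
      qed (auto simp: not_less indicator_def)
    qed
    then have "AE x in M. nn_cond_exp M (F j) (\<lambda>x. ?i x * ennreal ((mdiff ?a (Suc j) x)\<^sup>2)) x
        = nn_cond_exp M (F j) (\<lambda>x. 0) x"
      by (rule F.nn_cond_exp_cong) measurable
    moreover have "AE x in M. 0 = nn_cond_exp M (F j) (\<lambda>x. 0) x"
      by (rule F.nn_cond_exp_F_meas) measurable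
    moreover have "AE x in M. ?i x * cond_var M F ?a j x
        = nn_cond_exp M (F j) (\<lambda>x. ?i x * ennreal ((mdiff ?a (Suc j) x)\<^sup>2)) x"
      unfolding cond_var_def by (rule F.nn_cond_exp_prod) measurable
    ultimately show ?thesis
      using AE_space by eventually_elim (auto simp: not_le split: split_indicator_asm)
  qed
  then have "AE x in M. \<forall>j. enat j < \<nu> x \<longrightarrow> cond_var M F ?a j x = 0"
    by (intro AE_all_countable[THEN iffD2] allI)
  then show ?thesis
    by eventually_elim (auto simp: cond_square_eq ennpowr_def)
qed

text \<open>Chebyshev's inequality for the measure with density \<open>\<phi> x t\<close>: the size
  condition bounds the weighted mean of s(a) by 1 / L, and the factor L in the threshold cancels it.
  For q = \<infinity> any r > 0 is admissible: the tail is null if c <= z, and otherwise it lies in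
  \<open>B_set M \<nu>\<close> up to a null set while \<open>(c / z) powr r\<close> is at least
  1.\<close>

lemma satom_tail:
  assumes atom: "satom M F \<phi> q \<nu> a"
    and r: "0 < r" "q = \<infinity> \<or> r = enn2real q"
    and pos: "0 < z" "0 < t" "0 < c"
  shows "phi_mass M \<phi> {x\<in>space M. ennreal z <
        ennreal (c * enn2real (L_norm M \<phi> (indicator (B_set M \<nu>)))) *
        cond_square M F (\<lambda>n. real_cond_exp M (F n) a) x} t
    \<le> ennreal ((c / z) powr r) * phi_mass M \<phi> (B_set M \<nu>) t"
proof -
  define B where "B = B_set M \<nu>"
  define g where "g = cond_square M F (\<lambda>n. real_cond_exp M (F n) a)"
  have [measurable]: "g \<in> borel_measurable M"
    unfolding g_def by measurable
  have [measurable]: "(\<lambda>x. \<phi> x t) \<in> borel_measurable M"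
    using pos by (simp add: measurable_phi)
  have B: "B \<in> sets M"
    unfolding B_def using atom by (intro B_set_in_sets) (simp add: satom_def)
  show ?thesis
  proof (cases "emeasure M B = 0")
    \<comment> \<open>The norm of the indicator of a null set is 0, so the tail set is
      empty.\<close>
    case True
    then show ?thesis
      using B L_norm_indicator_null[OF B] by (simp add: B_def phi_mass_def)
  next
    case False
    obtain L where L: "0 < L" "L_norm M \<phi> (indicator B) = ennreal L"
      "inverse (L_norm M \<phi> (indicator B)) = ennreal (1 / L)"
      using L_norm_indicator_real[OF B False] by metis
    define A where "A = {x\<in>space M. ennreal z < ennreal (c * L) * g x}"
    have [measurable]: "A \<in> sets M"
      unfolding A_def by measurable
    have Lq: "Lq_norm M \<phi> q B g \<le> ennreal (1 / L)"
      using atom False L by (simp add: satom_def B_def g_def)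
    have "phi_mass M \<phi> A t \<le> ennreal ((c / z) powr r) * phi_mass M \<phi> B t"
    proof (cases "q = \<infinity>")
      case True
      with Lq have "esssup M g \<le> ennreal (1 / L)" by (simp add: Lq_norm_def)
      then have "AE x in M. g x \<le> ennreal (1 / L)"
        using esssup_AE[of g M] by (auto elim!: eventually_mono intro: order_trans)
      then have le: "AE x in M. ennreal (c * L) * g x \<le> ennreal c"
      proof eventually_elim
        case (elim x)
        have "ennreal (c * L) * g x \<le> ennreal (c * L) * ennreal (1 / L)"
          by (intro mult_left_mono elim) simp
        also have "\<dots> = ennreal c"
          using L pos by (subst ennreal_mult[symmetric]) auto
        finally show ?case .
      qed
      show ?thesis
      proof (cases "c \<le> z")
        case True
        from le have "AE x in M. x \<in> A \<longrightarrow> x \<in> {}"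
        proof eventually_elim
          case (elim x)
          have "ennreal c \<le> ennreal z" using True by (rule ennreal_leI)
          with elim show ?case by (auto simp: A_def)
        qed
        then have "phi_mass M \<phi> A t \<le> phi_mass M \<phi> {} t" by (rule phi_mass_mono_AE)
        then show ?thesis by (simp add: phi_mass_def)
      next
        case False
        have "AE x in M. x \<in> A \<longrightarrow> x \<in> B"
          using satom_cond_square_zero[OF atom]
          by eventually_elim (auto simp: A_def B_def B_set_def g_def)
        then have "phi_mass M \<phi> A t \<le> 1 * phi_mass M \<phi> B t"
          by (simp add: phi_mass_mono_AE)
        also have "\<dots> \<le> ennreal ((c / z) powr r) * phi_mass M \<phi> B t"
          using False pos r by (intro mult_right_mono) (auto simp: ge_one_powr_ge_zero)
        finally show ?thesis .
      qed
    next
      case q: False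
      then have r': "r = enn2real q" using r by simp
      define m where "m = enn2real (phi_mass M \<phi> B t)"
      have m_eq: "phi_mass M \<phi> B t = ennreal m"
        using phi_mass_finite[OF pos(2), of B] by (simp add: m_def)
      have "m \<noteq> 0"
        using phi_mass_eq_0_iff[OF pos(2) B] False m_eq by auto
      then have m: "0 < m"
        using enn2real_nonneg[of "phi_mass M \<phi> B t"] unfolding m_def[symmetric] by auto
      define I where "I = (\<integral>\<^sup>+x. ennpowr (g x) r * ennreal (\<phi> x t) \<partial>M)"
      \<comment> \<open>The supremum over all levels in \<open>Lq_norm\<close> is evaluated at the
        given \<open>t\<close>.\<close>
      have "ennpowr (1 / phi_mass M \<phi> B t * I) (1 / r) \<le> Lq_norm M \<phi> q B g"
        using q pos by (auto simp: Lq_norm_def r' I_def intro!: SUP_upper)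
      also note Lq
      finally have "1 / phi_mass M \<phi> B t * I \<le> ennreal ((1 / L) powr r)"
        using r L by (subst (asm) ennpowr_le_ennreal_iff) auto
      then have "ennreal m * (ennreal (1 / m) * I) \<le> ennreal m * ennreal ((1 / L) powr r)"
        using m m_eq by (intro mult_left_mono) (auto simp: divide_ennreal[symmetric] simp flip: ennreal_1)
      then have I: "I \<le> ennreal (m * (1 / L) powr r)"
        using m by (simp add: mult.assoc[symmetric] ennreal_mult[symmetric])
      \<comment> \<open>Chebyshev: \<open>g\<close> is at least z / (c L) on
        \<open>A\<close>.\<close>
      have "ennreal ((z / (c * L)) powr r) * phi_mass M \<phi> A t
          = (\<integral>\<^sup>+x. ennreal ((z / (c * L)) powr r) * (ennreal (\<phi> x t) * indicator A x) \<partial>M)"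
        unfolding phi_mass_def by (rule nn_integral_cmult[symmetric]) measurable
      also have "\<dots> \<le> I"
        unfolding I_def
      proof (rule nn_integral_mono)
        fix x assume "x \<in> space M"
        have "ennreal ((z / (c * L)) powr r) \<le> ennpowr (g x) r" if "x \<in> A"
        proof -
          have "ennreal z \<le> ennreal (c * L) * g x"
            using that by (simp add: A_def less_imp_le)
          then have "ennreal (1 / (c * L)) * ennreal z \<le> ennreal (1 / (c * L)) * (ennreal (c * L) * g x)"
            by (intro mult_left_mono) auto
          then have "ennreal (z / (c * L)) \<le> g x"
            using pos L by (simp add: mult.assoc[symmetric] ennreal_mult[symmetric])
          then have "ennpowr (ennreal (z / (c * L))) r \<le> ennpowr (g x) r"
            using r by (simp add: ennpowr_le_iff)
          then show ?thesis
            using pos L by (simp add: ennpowr_ennreal)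
        qed
        then show "ennreal ((z / (c * L)) powr r) * (ennreal (\<phi> x t) * indicator A x)
            \<le> ennpowr (g x) r * ennreal (\<phi> x t)"
          by (auto intro: mult_right_mono split: split_indicator)
      qed
      also note I
      finally have "ennreal ((c * L / z) powr r) * (ennreal ((z / (c * L)) powr r) * phi_mass M \<phi> A t)
          \<le> ennreal ((c * L / z) powr r) * ennreal (m * (1 / L) powr r)"
        by (intro mult_left_mono) auto
      also have "\<dots> = ennreal ((c / z) powr r * m)"
        using m pos L by (simp add: ennreal_mult[symmetric] powr_divide powr_mult)
      also have "ennreal ((c * L / z) powr r) * (ennreal ((z / (c * L)) powr r) * phi_mass M \<phi> A t)
          = phi_mass M \<phi> A t"
        using pos L by (simp add: mult.assoc[symmetric] ennreal_mult[symmetric] powr_divide powr_mult)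
      finally show ?thesis
        using m by (simp add: m_eq ennreal_mult)
    qed
    then show ?thesis
      using L by (simp add: A_def B_def g_def)
  qed
qed

end

section \<open>Bounding the weak norm of s(f) through an atomic decomposition\<close>

lemma int_decode_abs_ge: "real i / 2 \<le> real_of_int \<bar>int_decode i\<bar>"
  by (auto simp: int_decode_def sum_decode_def elim!: evenE oddE)

text \<open>The enumeration \<open>int_decode\<close> of the integers alternates between the two
  signs, so the i-th integer has modulus at least i / 2, and a geometric series of ratio 2^(-d/2)
  dominates.\<close>

lemma summable_int_decode_weight:
  assumes "0 < d"
  shows "summable (\<lambda>i. 2 powr (- d * real_of_int \<bar>int_decode i\<bar>))"
proof (rule summable_comparison_test')
  show "summable (\<lambda>i. (2 powr (- d / 2)) ^ i)"
    using assms by (intro summable_geometric) (simp add: powr_less_one)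
  fix i :: nat
  have "2 powr (- d * real_of_int \<bar>int_decode i\<bar>) \<le> 2 powr (- d * (real i / 2))"
    using assms int_decode_abs_ge[of i] by (intro powr_mono) auto
  also have "\<dots> = (2 powr (- d / 2)) ^ i"
    by (simp add: powr_realpow[symmetric] powr_powr mult.commute)
  finally show "norm (2 powr (- d * real_of_int \<bar>int_decode i\<bar>)) \<le> (2 powr (- d / 2)) ^ i"
    by simp
qed

context musielak_orlicz_martingales
begin

lemma B_set_phi_mass_le:
  assumes "atomic_decomp M F \<phi> q Ct f a \<nu>"
    and "(SUP k. phi_mass M \<phi> (B_set M (\<nu> k)) (2 powi k / l)) \<le> 1"
  shows "phi_mass M \<phi> (B_set M (\<nu> k)) (2 powr real_of_int k / l) \<le> 1"
  using assms(2) by (simp add: SUP_le_iff powr_real_of_int')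

text \<open>\<open>N\<close> depends neither on f nor on its decomposition: the layer bounds add up
  to at most \<open>S\<close> for the mass of {s(f) > \<alpha>} at level \<alpha> / l, and
  \<open>phi_mass_rescale\<close> turns \<open>S\<close> into 1 at the price of replacing l by N
  l.\<close>

lemma WHs_norm_le_atomic:
  assumes q: "q > ennreal (max p_up 1)" and Ct: "0 < Ct"
  obtains N where "1 \<le> N"
    "\<And>f a \<nu> l. f \<in> martingales0 M F \<Longrightarrow> atomic_decomp M F \<phi> q Ct f a \<nu> \<Longrightarrow> 0 < l \<Longrightarrow>
      (SUP k. phi_mass M \<phi> (B_set M (\<nu> k)) (2 powi k / l)) \<le> 1 \<Longrightarrow>
      WHs_norm M F \<phi> f \<le> ennreal (N * l)"
proof -
  \<comment> \<open>The Chebyshev exponent: q itself when q is finite. For q = \<infinity> every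
    exponent above \<open>p_up\<close> is available, and \<open>p_up + 1\<close> is one of
    them.\<close>
  define r where "r = (if q = \<infinity> then p_up + 1 else enn2real q)"
  have r: "p_up < r" "q = \<infinity> \<or> r = enn2real q"
    using q p_up by (cases q; auto simp: r_def ennreal_less_iff)+
  then have r0: "0 < r" using p_up by simp
  obtain C where C: "1 \<le> C"
    "\<And>E s t. E \<in> sets M \<Longrightarrow> 0 < t \<Longrightarrow> 0 < s \<Longrightarrow> s \<le> 1 \<Longrightarrow>
      phi_mass M \<phi> E (s * t) \<le> ennreal (C * s powr p_lo) * phi_mass M \<phi> E t"
    "\<And>E s t. E \<in> sets M \<Longrightarrow> 0 < t \<Longrightarrow> 1 \<le> s \<Longrightarrow>
      phi_mass M \<phi> E (s * t) \<le> ennreal (C * s powr p_up) * phi_mass M \<phi> E t"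
    using phi_mass_types by metis
  \<comment> \<open>With \<open>\<delta> = \<eta> / r\<close> the weights cost a factor \<open>2 powr (\<eta> n)\<close> in the Chebyshev bound for the
    layer \<open>n\<close> steps below the level \<open>\<alpha>\<close>, against a gain of \<open>2 powr (- 2 \<eta> n)\<close> from \<open>p_up < r\<close>.\<close>
  define \<eta> where "\<eta> = (r - p_up) / 2"
  define \<delta> where "\<delta> = \<eta> / r"
  have \<eta>: "0 < \<eta>" and \<delta>: "0 < \<delta>" using r r0 by (auto simp: \<eta>_def \<delta>_def)
  \<comment> \<open>Two-sided geometric weights, listed along \<open>int_decode\<close>. The
    exponent \<delta> serves Cauchy--Schwarz, \<open>p_lo\<close> the layers at or above the level
    of \<alpha>, and \<eta> those below it.\<close>
  define v :: "real \<Rightarrow> nat \<Rightarrow> real" where "v d i = 2 powr (- d * real_of_int \<bar>int_decode i\<bar>)" for d i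
  have v: "0 < v d i" "0 < d \<Longrightarrow> summable (v d)" for d i
    using summable_int_decode_weight[of d] by (auto simp: v_def[abs_def])
  define W where "W = suminf (v \<delta>)"
  have W: "0 < W"
    unfolding W_def using v \<delta> by (intro suminf_pos) auto
  \<comment> \<open>(Ct W)^r comes from the threshold in Chebyshev's inequality, C from the upper
    type, and 2^(2 \<eta>) from the loss of one dyadic step, as the lower bound for \<alpha> is
    2^(k0 - 1).\<close>
  define K where "K = (Ct * W) powr r * C * 2 powr (2 * \<eta>)"
  have K: "0 \<le> K" using C by (simp add: K_def)
  define S where "S = C * suminf (v p_lo) + K * suminf (v \<eta>)"
  have S: "(\<lambda>i. C * v p_lo i + K * v \<eta> i) sums S"
    unfolding S_def using v p_lo \<eta> by (intro sums_add sums_mult summable_sums) auto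
  have S0: "0 \<le> S"
    using S sums_le[OF _ sums_zero S] C K v by (simp add: less_imp_le)
  obtain N where N: "1 \<le> N"
    "\<And>E t. E \<in> sets M \<Longrightarrow> 0 < t \<Longrightarrow> phi_mass M \<phi> E t \<le> ennreal S \<Longrightarrow> phi_mass M \<phi> E (t / N) \<le> 1"
    using phi_mass_rescale[OF S0] by metis
  show thesis
  proof (rule that[OF N(1)])
    fix f a \<nu> l
    assume f: "f \<in> martingales0 M F" and dec: "atomic_decomp M F \<phi> q Ct f a \<nu>" and l: "0 < l"
      and sup: "(SUP k. phi_mass M \<phi> (B_set M (\<nu> k)) (2 powi k / l)) \<le> 1"
    note mass1 = B_set_phi_mass_le[OF dec sup]
    have atom: "satom M F \<phi> q (\<nu> k) (a k)" for k
      using dec by (simp add: atomic_decomp_def)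
    have st: "ext_stopping_time F (\<nu> k)" for k
      using atom by (simp add: satom_def)
    have B [measurable]: "B_set M (\<nu> k) \<in> sets M" for k
      using st by (rule B_set_in_sets)
    define g where "g k = cond_square M F (\<lambda>n. real_cond_exp M (F n) (a k))" for k
    have [measurable]: "g k \<in> borel_measurable M" for k
      unfolding g_def by measurable
    define c where "c k = atom_coeff M \<phi> Ct \<nu> k" for k
    have c: "c k = Ct * 2 powr real_of_int k * enn2real (L_norm M \<phi> (indicator (B_set M (\<nu> k))))" for k
      by (simp add: c_def atom_coeff_def powr_real_of_int')
    have f_meas: "f n \<in> borel_measurable M" for n
      using f by (intro measurable_F_M[of _ n]) (auto simp: martingales0_def)
    have main: "phi_mass M \<phi> {x\<in>space M. ennreal \<alpha> < cond_square M F f x} (\<alpha> / l) \<le> ennreal S"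
      if \<alpha>: "0 < \<alpha>" for \<alpha>
    proof -
      \<comment> \<open>The dyadic level of \<alpha>. The layers are numbered relative to it, so
        that \<open>int_decode i\<close> is the signed distance of the i-th layer.\<close>
      define k0 where "k0 = \<lceil>log 2 \<alpha>\<rceil>"
      have k0: "2 powr (real_of_int k0 - 1) < \<alpha>" "\<alpha> \<le> 2 powr real_of_int k0"
        using \<alpha> ceiling_correct[of "log 2 \<alpha>"]
        by (auto simp: k0_def less_log_iff[symmetric] log_le_iff[symmetric] powr_less_iff le_powr_iff)
      define k where "k i = k0 + int_decode i" for i
      \<comment> \<open>The factor by which the level \<open>2 powr k / l\<close>, where the mass of
        \<open>B_set\<close> is at most 1, has to be scaled to reach \<alpha> / l.\<close>
      define u where "u i = \<alpha> / 2 powr real_of_int (k i)" for i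
      have u0: "0 < u i" for i using \<alpha> by (simp add: u_def)
      have u_t: "u i * (2 powr real_of_int (k i) / l) = \<alpha> / l" for i
        by (simp add: u_def)
      have u_le: "u i \<le> 2 powr (- real_of_int (int_decode i))" for i
        using k0(2) by (simp add: u_def k_def powr_add powr_minus field_simps)
      have u_gt: "2 powr (- real_of_int (int_decode i) - 1) < u i" for i
        using k0(1) by (simp add: u_def k_def powr_add powr_minus powr_diff field_simps)
      define E where "E i = {x\<in>space M. ennreal (\<alpha> * v \<delta> i / W) < ennreal (c (k i)) * g (k i) x}" for i
      have E [measurable]: "E i \<in> sets M" for i
        unfolding E_def by measurable
      have "AE x in M. \<forall>\<alpha>>0. ennreal \<alpha> < cond_square M F f x \<longrightarrow>
        (\<exists>i. ennreal (\<alpha> * v \<delta> i / suminf (v \<delta>)) < ennreal (c (k i)) * g (k i) x)"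
        unfolding g_def
      proof (rule cond_square_decomp)
        fix n
        have "AE x in M. ((\<lambda>k. c k * real_cond_exp M (F n) (a k) x) has_sum f n x) UNIV"
          using dec by (simp add: atomic_decomp_def c_def)
        then show "AE x in M. (\<lambda>i. c (k i) * real_cond_exp M (F n) (a (k i)) x) sums f n x"
        proof eventually_elim
          case (elim x)
          \<comment> \<open>The decomposition converges unconditionally in the sense of
            \<open>has_sum\<close>, so it may be re-enumerated along \<open>k\<close>.\<close>
          have "bij_betw k UNIV UNIV"
            unfolding k_def using bij_comp[OF bij_int_decode bij_plus_right[of k0]]
            by (simp add: comp_def add.commute)
          from has_sum_reindex_bij_betw[OF this, THEN iffD2, OF elim] show ?case
            by (rule has_sum_imp_sums)
        qed
      next
        show "0 \<le> c (k i)" for i using Ct by (simp add: c)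
      qed (use v \<delta> f_meas borel_measurable_cond_exp2 in auto)
      then have "AE x in M. x \<in> {x\<in>space M. ennreal \<alpha> < cond_square M F f x} \<longrightarrow> (\<exists>i. x \<in> E i)"
        by eventually_elim (use \<alpha> in \<open>auto simp: E_def W_def\<close>)
      then have "phi_mass M \<phi> {x\<in>space M. ennreal \<alpha> < cond_square M F f x} (\<alpha> / l)
          \<le> (\<Sum>i. phi_mass M \<phi> (E i) (\<alpha> / l))"
        using \<alpha> l by (intro phi_mass_le_suminf E) auto
      also have "\<dots> \<le> (\<Sum>i. ennreal (C * v p_lo i + K * v \<eta> i))"
      proof (intro suminf_le)
        fix i
        let ?B = "B_set M (\<nu> (k i))"
        show "phi_mass M \<phi> (E i) (\<alpha> / l) \<le> ennreal (C * v p_lo i + K * v \<eta> i)"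
        proof (cases "0 \<le> int_decode i")
          case True
          then have u1: "u i \<le> 1"
            using order_trans[OF u_le[of i] powr_mono[of _ 0 2]] by simp
          have "AE x in M. x \<in> E i \<longrightarrow> x \<in> ?B"
            using satom_cond_square_zero[OF atom, of "k i"]
            by eventually_elim (auto simp: E_def g_def B_set_def)
          then have "phi_mass M \<phi> (E i) (\<alpha> / l) \<le> phi_mass M \<phi> ?B (u i * (2 powr real_of_int (k i) / l))"
            unfolding u_t by (rule phi_mass_mono_AE)
          also have "\<dots> \<le> ennreal (C * u i powr p_lo) * phi_mass M \<phi> ?B (2 powr real_of_int (k i) / l)"
            using l u0 u1 by (intro C(2) B) auto
          also have "\<dots> \<le> ennreal (C * u i powr p_lo) * 1"
            by (intro mult_left_mono mass1) simp
          also have "\<dots> \<le> ennreal (C * v p_lo i + K * v \<eta> i)"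
          proof -
            have "u i powr p_lo \<le> (2 powr (- real_of_int (int_decode i))) powr p_lo"
              using u0[of i] u_le p_lo by (intro powr_mono2) (auto simp: less_imp_le)
            also have "\<dots> = v p_lo i"
              using True by (simp add: v_def powr_powr mult.commute)
            finally have "C * u i powr p_lo + 0 \<le> C * v p_lo i + K * v \<eta> i"
              using C(1) K v(1)[of \<eta> i] by (intro add_mono mult_left_mono) auto
            then show ?thesis by (simp add: ennreal_leI)
          qed
          finally show ?thesis .
        next
          case False
          define n where "n = - real_of_int (int_decode i)"
          have n: "1 \<le> n" "real_of_int \<bar>int_decode i\<bar> = n"
            using False by (auto simp: n_def)
          have un: "2 powr (n - 1) < u i"
            using u_gt[of i] by (simp add: n_def)
          moreover have "1 \<le> 2 powr (n - 1)"
            using n by (intro ge_one_powr_ge_zero) auto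
          ultimately have u1: "1 \<le> u i" by simp
          \<comment> \<open>The factor supplied by \<open>satom_tail\<close> with c = Ct 2^k and z =
            \<alpha> w / W. As \<delta> r = \<eta>, the weight w contributes 2^(\<eta> n).\<close>
          let ?d = "(Ct * 2 powr real_of_int (k i) / (\<alpha> * v \<delta> i / W)) powr r"
          have d: "?d = (Ct * W) powr r * u i powr (- r) * 2 powr (\<eta> * n)"
          proof -
            have "Ct * 2 powr real_of_int (k i) / (\<alpha> * v \<delta> i / W) = Ct * W * (1 / u i) * (1 / v \<delta> i)"
              by (simp add: u_def)
            also have "\<dots> powr r = (Ct * W) powr r * u i powr (- r) * (1 / v \<delta> i) powr r"
              using Ct W u0[of i] v(1)[of \<delta> i] by (simp add: powr_mult powr_divide powr_minus_divide)
            also have "(1 / v \<delta> i) powr r = 2 powr (\<eta> * n)"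
              using r0 n by (simp add: v_def powr_minus_divide[symmetric] powr_powr \<delta>_def)
            finally show ?thesis .
          qed
          have "phi_mass M \<phi> (E i) (\<alpha> / l) \<le> ennreal ?d * phi_mass M \<phi> ?B (\<alpha> / l)"
            unfolding E_def c g_def using atom r r0 \<alpha> l Ct W v(1)[of \<delta> i]
            by (intro satom_tail) auto
          also have "\<dots> = ennreal ?d * phi_mass M \<phi> ?B (u i * (2 powr real_of_int (k i) / l))"
            unfolding u_t ..
          also have "\<dots> \<le> ennreal ?d * (ennreal (C * u i powr p_up) * phi_mass M \<phi> ?B (2 powr real_of_int (k i) / l))"
            using l u1 by (intro mult_left_mono C(3) B) auto
          also have "\<dots> \<le> ennreal ?d * (ennreal (C * u i powr p_up) * 1)"
            by (intro mult_left_mono mass1) auto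
          also have "\<dots> = ennreal (?d * (C * u i powr p_up))"
            using C(1) by (simp add: ennreal_mult)
          also have "\<dots> \<le> ennreal (C * v p_lo i + K * v \<eta> i)"
          proof (rule ennreal_leI)
            \<comment> \<open>Upper type and Chebyshev combine to u^(p_up - r) = u^(-2 \<eta>).
              Since u > 2^(n - 1) and the exponent is negative, this is at most 2^(2 \<eta>) 2^(-2
              \<eta> n); multiplied by 2^(\<eta> n) it leaves a decay of 2^(-\<eta> n).\<close>
            have "?d * (C * u i powr p_up) = (Ct * W) powr r * C * 2 powr (\<eta> * n) * (u i powr (- r) * u i powr p_up)"
              unfolding d by simp
            also have "u i powr (- r) * u i powr p_up = u i powr (- (2 * \<eta>))"
              by (simp add: powr_add[symmetric] \<eta>_def diff_divide_distrib)
            also have "(Ct * W) powr r * C * 2 powr (\<eta> * n) * u i powr (- (2 * \<eta>))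
                \<le> (Ct * W) powr r * C * 2 powr (\<eta> * n) * (2 powr (n - 1)) powr (- (2 * \<eta>))"
              using un \<eta> C(1) by (intro mult_left_mono powr_mono2') auto
            also have "\<dots> = K * v \<eta> i"
              using n by (simp add: K_def v_def powr_powr powr_add[symmetric] algebra_simps)
            also have "\<dots> \<le> C * v p_lo i + K * v \<eta> i"
              using C(1) v(1)[of p_lo i] by simp
            finally show "?d * (C * u i powr p_up) \<le> C * v p_lo i + K * v \<eta> i" .
          qed
          finally show ?thesis .
        qed
      qed auto
      also have "\<dots> = ennreal S"
        using C(1) K v(1) by (intro suminf_ennreal_eq S) (auto simp: less_imp_le)
      finally show ?thesis .
    qed
    have "phi_mass M \<phi> {x\<in>space M. ennreal \<alpha> < cond_square M F f x} (\<alpha> / (N * l)) \<le> 1"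
      if "0 < \<alpha>" for \<alpha>
      using N(2)[OF _ _ main[OF that]] that l by (simp add: mult.commute)
    then have "(SUP \<alpha>\<in>{0<..}. phi_mass M \<phi> {x\<in>space M. ennreal \<alpha> < cond_square M F f x} (\<alpha> / (N * l))) \<le> 1"
      by (intro SUP_least) auto
    then show "WHs_norm M F \<phi> f \<le> ennreal (N * l)"
      unfolding WHs_norm_def WL_norm_def using N(1) l by (intro Inf_lower imageI) auto
  qed
qed

end

section \<open>Terminal values of martingales bounded in the mean square\<close>

text \<open>The partial sums converge in \<open>L\<^sup>2\<close>; weak convergence along a subsequence with summable
  increments is all that identifying conditional expectations takes.\<close>

lemma (in prob_space) orthogonal_series_limit:
  fixes Y :: "nat \<Rightarrow> 'a \<Rightarrow> real"
  assumes [measurable]: "\<And>j. Y j \<in> borel_measurable M"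
    and sq: "\<And>j. integrable M (\<lambda>x. (Y j x)\<^sup>2)"
    and int: "\<And>i j. integrable M (\<lambda>x. Y i x * Y j x)"
    and orth: "\<And>i j. i < j \<Longrightarrow> (\<integral>x. Y i x * Y j x \<partial>M) = 0"
    and bound: "\<And>n. (\<Sum>j<n. \<integral>x. (Y j x)\<^sup>2 \<partial>M) \<le> K"
  shows "\<exists>a r. integrable M a \<and> (\<forall>n. n \<le> r n) \<and> (\<forall>A\<in>sets M.
    (\<lambda>n. \<integral>x. indicator A x * (\<Sum>j<r n. Y j x) \<partial>M) \<longlonglongrightarrow> (\<integral>x. indicator A x * a x \<partial>M))"
proof -
  define V where "V j = (\<integral>x. (Y j x)\<^sup>2 \<partial>M)" for j
  have V0: "0 \<le> V j" for j by (simp add: V_def)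
  have V: "summable V"
    using V0 bound by (intro summableI_nonneg_bounded[where x=K]) (auto simp: V_def)
  \<comment> \<open>Blocks with second moment at most 4^(-k) have first moment at most 2^(-k), so
    their L^1 norms are summable.\<close>
  have "\<exists>N. \<forall>m\<ge>N. \<forall>n. norm (sum V {m..<n}) < (1/4) ^ k" for k :: nat
    using V[unfolded summable_Cauchy] by simp
  then obtain N where N: "\<And>k m n. N k \<le> m \<Longrightarrow> norm (sum V {m..<n}) < (1/4) ^ k"
    by metis
  \<comment> \<open>Adding up all bounds so far makes \<open>r\<close> increasing and places it
    beyond both \<open>k\<close> and \<open>N k\<close>.\<close>
  define r where "r k = k + (\<Sum>i\<le>k. N i)" for k
  have r: "k \<le> r k" "N k \<le> r k" "r k \<le> r (Suc k)" for k
    by (auto simp: r_def intro: trans_le_add2 member_le_sum)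
  define S where "S n x = (\<Sum>j<n. Y j x)" for n x
  define D where "D k x = S (r (Suc k)) x - S (r k) x" for k x
  have [measurable]: "S n \<in> borel_measurable M" "D n \<in> borel_measurable M" for n
    unfolding S_def D_def by measurable
  have D_sum: "D k x = (\<Sum>j=r k..<r (Suc k). Y j x)" for k x
    using sum_diff_nat_ivl[of 0 "r k" "r (Suc k)" "\<lambda>j. Y j x"] r
    by (simp add: D_def S_def atLeast0LessThan)
  have Y1: "integrable M (Y j)" for j
    using sq by (rule square_integrable_imp_integrable[rotated]) measurable
  have S1: "integrable M (S n)" for n
    unfolding S_def using Y1 by (intro Bochner_Integration.integrable_sum)
  have D1: "integrable M (D k)" for k
    unfolding D_def using S1 by (intro Bochner_Integration.integrable_diff)
  have orth': "(\<integral>x. Y i x * Y j x \<partial>M) = (if i = j then V i else 0)" for i j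
    using orth[of i j] orth[of j i] by (cases i j rule: linorder_cases) (auto simp: V_def power2_eq_square mult.commute)
  have D_sq: "(D k x)\<^sup>2 = (\<Sum>i=r k..<r (Suc k). \<Sum>j=r k..<r (Suc k). Y i x * Y j x)" for k x
    by (simp add: D_sum power2_eq_square sum_product)
  have D2: "integrable M (\<lambda>x. (D k x)\<^sup>2)" for k
    unfolding D_sq using int by (intro Bochner_Integration.integrable_sum)
  have D2_le: "(\<integral>x. (D k x)\<^sup>2 \<partial>M) \<le> (1/4) ^ k" for k
  proof -
    have "(\<integral>x. (D k x)\<^sup>2 \<partial>M) = (\<Sum>i=r k..<r (Suc k). \<Sum>j=r k..<r (Suc k). \<integral>x. Y i x * Y j x \<partial>M)"
      unfolding D_sq using int by (simp add: Bochner_Integration.integral_sum Bochner_Integration.integrable_sum)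
    also have "\<dots> = sum V {r k..<r (Suc k)}"
      unfolding orth' by (intro sum.cong) auto
    also have "\<dots> \<le> (1/4) ^ k"
      using N[OF r(2)[of k], of "r (Suc k)"] by simp
    finally show ?thesis .
  qed
  have D1_le: "(\<integral>x. \<bar>D k x\<bar> \<partial>M) \<le> (1/2) ^ k" for k
  proof -
    \<comment> \<open>The arithmetic-geometric mean inequality, scaled by 2^k, takes the place of
      Cauchy--Schwarz for integrals.\<close>
    have "(\<integral>x. \<bar>D k x\<bar> \<partial>M) \<le> (\<integral>x. ((1/2) ^ k + 2 ^ k * (D k x)\<^sup>2) / 2 \<partial>M)"
    proof (rule integral_mono)
      fix x
      have "0 \<le> 2 ^ k * (\<bar>D k x\<bar> - (1/2) ^ k)\<^sup>2" by simp
      also have "\<dots> = 2 ^ k * (D k x)\<^sup>2 - 2 * \<bar>D k x\<bar> + (1/2) ^ k"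
        by (simp add: power2_diff algebra_simps power2_eq_square power_divide)
      finally show "\<bar>D k x\<bar> \<le> ((1/2) ^ k + 2 ^ k * (D k x)\<^sup>2) / 2" by simp
    qed (use D1 D2 in auto)
    also have "\<dots> = ((1/2) ^ k + 2 ^ k * (\<integral>x. (D k x)\<^sup>2 \<partial>M)) / 2"
      using D2 by (simp add: prob_space)
    also have "\<dots> \<le> ((1/2) ^ k + 2 ^ k * (1/4) ^ k) / 2"
      using D2_le[of k] by (intro divide_right_mono add_mono mult_left_mono) auto
    also have "\<dots> = (1/2) ^ k"
      by (simp add: power_mult_distrib[symmetric])
    finally show ?thesis .
  qed
  have sumD: "summable (\<lambda>k. \<integral>x. norm (D k x) \<partial>M)"
    using D1_le by (intro summable_comparison_test'[OF summable_geometric[of "1/2::real"]]) auto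
  have "(\<integral>\<^sup>+x. (\<Sum>k. ennreal (norm (D k x))) \<partial>M) = (\<Sum>k. \<integral>\<^sup>+x. ennreal (norm (D k x)) \<partial>M)"
    by (rule nn_integral_suminf) measurable
  also have "\<dots> = (\<Sum>k. ennreal (\<integral>x. norm (D k x) \<partial>M))"
    using D1 by (intro suminf_cong nn_integral_eq_integral) auto
  also have "\<dots> \<noteq> \<infinity>"
    unfolding infinity_ennreal_def using sumD by (rule ennreal_suminf_neq_top) simp
  finally have "AE x in M. (\<Sum>k. ennreal (norm (D k x))) \<noteq> \<infinity>"
    by (intro nn_integral_noteq_infinite) measurable
  then have AEsum: "AE x in M. summable (\<lambda>k. norm (D k x))"
    by eventually_elim (auto intro: summable_suminf_not_top)
  \<comment> \<open>The telescoped form of the limit of \<open>S (r n)\<close>. The value of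
    \<open>suminf\<close> on the null set where the blocks are not absolutely summable does not
    affect any integral.\<close>
  define a where "a x = S (r 0) x + (\<Sum>k. D k x)" for x
  have intD: "integrable M (\<lambda>x. \<Sum>k. D k x)"
    using D1 AEsum sumD by (rule integrable_suminf)
  show ?thesis
  proof (intro exI conjI allI ballI)
    show "integrable M a"
      unfolding a_def using S1 intD by (intro Bochner_Integration.integrable_add)
    show "n \<le> r n" for n by (rule r)
    fix A assume [measurable]: "A \<in> sets M"
    have iA: "integrable M (\<lambda>x. indicator A x * g x)" if "integrable M g" for g :: "'a \<Rightarrow> real"
      using integrable_real_mult_indicator[OF _ that, of A] by (simp add: mult.commute)
    have "(\<lambda>k. \<integral>x. indicator A x * D k x \<partial>M) sums (\<integral>x. (\<Sum>k. indicator A x * D k x) \<partial>M)"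
    proof (rule sums_integral)
      show "AE x in M. summable (\<lambda>k. norm (indicator A x * D k x))"
        using AEsum by eventually_elim (auto split: split_indicator)
      show "summable (\<lambda>k. \<integral>x. norm (indicator A x * D k x) \<partial>M)"
      proof (rule summable_comparison_test'[OF sumD])
        fix k
        have "(\<integral>x. norm (indicator A x * D k x) \<partial>M) \<le> (\<integral>x. norm (D k x) \<partial>M)"
          using D1 iA by (intro integral_mono integrable_norm) (auto split: split_indicator)
        then show "norm (\<integral>x. norm (indicator A x * D k x) \<partial>M) \<le> (\<integral>x. norm (D k x) \<partial>M)"
          by simp
      qed
    qed (use D1 iA in auto)
    then have "(\<lambda>n. (\<integral>x. indicator A x * S (r 0) x \<partial>M) + (\<Sum>k<n. \<integral>x. indicator A x * D k x \<partial>M))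
        \<longlonglongrightarrow> (\<integral>x. indicator A x * S (r 0) x \<partial>M) + (\<integral>x. (\<Sum>k. indicator A x * D k x) \<partial>M)"
      unfolding sums_def by (intro tendsto_intros)
    also have "(\<lambda>n. (\<integral>x. indicator A x * S (r 0) x \<partial>M) + (\<Sum>k<n. \<integral>x. indicator A x * D k x \<partial>M))
        = (\<lambda>n. \<integral>x. indicator A x * S (r n) x \<partial>M)"
    proof
      fix n
      show "(\<integral>x. indicator A x * S (r 0) x \<partial>M) + (\<Sum>k<n. \<integral>x. indicator A x * D k x \<partial>M)
        = (\<integral>x. indicator A x * S (r n) x \<partial>M)"
      proof (induction n)
        case (Suc n)
        have "(\<integral>x. indicator A x * S (r n) x \<partial>M) + (\<integral>x. indicator A x * D n x \<partial>M)
            = (\<integral>x. indicator A x * S (r n) x + indicator A x * D n x \<partial>M)"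
          using iA S1 D1 by (intro Bochner_Integration.integral_add[symmetric]) auto
        also have "\<dots> = (\<integral>x. indicator A x * S (r (Suc n)) x \<partial>M)"
          by (simp add: D_def algebra_simps)
        finally show ?case using Suc by simp
      qed simp
    qed
    also have "(\<integral>x. indicator A x * S (r 0) x \<partial>M) + (\<integral>x. (\<Sum>k. indicator A x * D k x) \<partial>M)
        = (\<integral>x. indicator A x * S (r 0) x + indicator A x * (\<Sum>k. D k x) \<partial>M)"
    proof -
      have "(\<lambda>x. \<Sum>k. indicator A x * D k x) = (\<lambda>x. indicator A x * (\<Sum>k. D k x) :: real)"
        by (auto split: split_indicator)
      then show ?thesis
        using iA S1 intD by (subst Bochner_Integration.integral_add) auto
    qed
    also have "\<dots> = (\<integral>x. indicator A x * a x \<partial>M)"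
      by (simp add: a_def distrib_left)
    finally show "(\<lambda>n. \<integral>x. indicator A x * (\<Sum>j<r n. Y j x) \<partial>M) \<longlonglongrightarrow> (\<integral>x. indicator A x * a x \<partial>M)"
      by (simp add: S_def)
  qed
qed

context filtered_prob_space
begin

text \<open>E_j Y_j = 0 makes Y_j orthogonal to every F_j-measurable factor. With the factor Y_i, i
  < j, this gives the orthogonality needed for the limit; with the indicator of a set A in F_n it
  shows that the integrals of the partial sums over A are constant from n on, so the limit has the
  required conditional expectations.\<close>

lemma L2_bounded_martingale_closed:
  fixes Y :: "nat \<Rightarrow> 'a \<Rightarrow> real"
  assumes Y [measurable]: "\<And>j. Y j \<in> borel_measurable (F (Suc j))"
    and sq: "\<And>j. integrable M (\<lambda>x. (Y j x)\<^sup>2)"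
    and mart: "\<And>j. AE x in M. real_cond_exp M (F j) (Y j) x = 0"
    and bound: "\<And>n. (\<Sum>j<n. \<integral>x. (Y j x)\<^sup>2 \<partial>M) \<le> K"
  obtains a where "integrable M a"
    "\<And>n. AE x in M. real_cond_exp M (F n) a x = (\<Sum>j<n. Y j x)"
proof -
  have YM [measurable]: "Y j \<in> borel_measurable M" for j
    using Y by (rule measurable_F_M)
  have int: "integrable M (\<lambda>x. Y i x * Y j x)" for i j
  proof (rule Bochner_Integration.integrable_bound)
    show "integrable M (\<lambda>x. (Y i x)\<^sup>2 + (Y j x)\<^sup>2)"
      using sq by (intro Bochner_Integration.integrable_add)
    have "\<bar>u * v\<bar> \<le> u\<^sup>2 + v\<^sup>2" for u v :: real
    proof -
      have "0 \<le> (\<bar>u\<bar> - \<bar>v\<bar>)\<^sup>2" by simp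
      then have "2 * (\<bar>u\<bar> * \<bar>v\<bar>) \<le> u\<^sup>2 + v\<^sup>2" by (simp add: power2_diff)
      moreover have "0 \<le> \<bar>u\<bar> * \<bar>v\<bar>" by simp
      ultimately show ?thesis unfolding abs_mult by linarith
    qed
    then show "AE x in M. norm (Y i x * Y j x) \<le> norm ((Y i x)\<^sup>2 + (Y j x)\<^sup>2)"
      by simp
  qed measurable
  have Y1: "integrable M (Y j)" for j
    using sq by (rule square_integrable_imp_integrable[rotated]) measurable
  have zero: "(\<integral>x. g x * Y j x \<partial>M) = 0"
    if "g \<in> borel_measurable (F j)" "integrable M (\<lambda>x. g x * Y j x)" for g j
  proof -
    have [measurable]: "g \<in> borel_measurable M" using that by (intro measurable_F_M)
    have [measurable]: "real_cond_exp M (F j) (Y j) \<in> borel_measurable M"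
      by (rule borel_measurable_cond_exp2)
    have "(\<integral>x. g x * Y j x \<partial>M) = (\<integral>x. g x * real_cond_exp M (F j) (Y j) x \<partial>M)"
      using that YM by (intro F.real_cond_exp_intg(2)[symmetric]) auto
    also have "\<dots> = (\<integral>x. 0 \<partial>M)"
      using mart[of j] by (intro integral_cong_AE) auto
    finally show ?thesis by simp
  qed
  have orth: "(\<integral>x. Y i x * Y j x \<partial>M) = 0" if "i < j" for i j
    using that int by (intro zero measurable_F_mono[OF Y]) auto
  obtain a r where a: "integrable M a" and r: "\<And>n. n \<le> r n" and lim: "\<And>A. A \<in> sets M \<Longrightarrow>
      (\<lambda>n. \<integral>x. indicator A x * (\<Sum>j<r n. Y j x) \<partial>M) \<longlonglongrightarrow> (\<integral>x. indicator A x * a x \<partial>M)"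
    using orthogonal_series_limit[OF YM sq int orth bound] by auto
  show thesis
  proof (rule that[OF a])
    fix n
    show "AE x in M. real_cond_exp M (F n) a x = (\<Sum>j<n. Y j x)"
    proof (rule F.real_cond_exp_charact)
      fix A assume A: "A \<in> sets (F n)"
      then have AM [measurable]: "A \<in> sets M"
        using subalgebra_F[of n] by (auto simp: subalgebra_def)
      have iA: "integrable M (\<lambda>x. indicator A x * Y j x)" for j
        using integrable_real_mult_indicator[OF AM Y1, of j] by (simp add: mult.commute)
      have eq: "(\<integral>x. indicator A x * (\<Sum>j<m. Y j x) \<partial>M) = (\<integral>x. indicator A x * (\<Sum>j<n. Y j x) \<partial>M)"
        if "n \<le> m" for m
        using that
      proof (induction m rule: dec_induct)
        case (step m)
        have iS: "integrable M (\<lambda>x. indicator A x * (\<Sum>j<m. Y j x))"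
          unfolding sum_distrib_left using iA by (intro Bochner_Integration.integrable_sum)
        have "(\<integral>x. indicator A x * (\<Sum>j<Suc m. Y j x) \<partial>M)
            = (\<integral>x. indicator A x * (\<Sum>j<m. Y j x) \<partial>M) + (\<integral>x. indicator A x * Y m x \<partial>M)"
          unfolding sum.lessThan_Suc distrib_left using iS iA
          by (rule Bochner_Integration.integral_add)
        also have "(\<integral>x. indicator A x * Y m x \<partial>M) = 0"
          using A iA step by (intro zero measurable_F_mono[OF borel_measurable_indicator[OF A]]) auto
        finally show ?case using step by simp
      qed simp
      have "(\<lambda>k. \<integral>x. indicator A x * (\<Sum>j<r k. Y j x) \<partial>M)
          \<longlonglongrightarrow> (\<integral>x. indicator A x * (\<Sum>j<n. Y j x) \<partial>M)"
      proof (rule tendsto_eventually, rule eventually_sequentiallyI)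
        fix k assume "n \<le> k"
        with r[of k] show "(\<integral>x. indicator A x * (\<Sum>j<r k. Y j x) \<partial>M)
            = (\<integral>x. indicator A x * (\<Sum>j<n. Y j x) \<partial>M)"
          by (intro eq) simp
      qed
      from LIMSEQ_unique[OF lim[OF AM] this]
      show "(\<integral>x\<in>A. a x \<partial>M) = (\<integral>x\<in>A. (\<Sum>j<n. Y j x) \<partial>M)"
        by (simp add: set_lebesgue_integral_def)
    next
      show "integrable M (\<lambda>x. \<Sum>j<n. Y j x)"
        using Y1 by (intro Bochner_Integration.integrable_sum)
      show "(\<lambda>x. \<Sum>j<n. Y j x) \<in> borel_measurable (F n)"
      proof (rule borel_measurable_sum)
        fix j assume "j \<in> {..<n}"
        then show "Y j \<in> borel_measurable (F n)" by (intro measurable_F_mono[OF Y]) auto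
      qed
    qed (rule a)
  qed
qed

end

section \<open>Dyadic layers of a martingale\<close>

text \<open>The partial sums of s(f)^2. By predictability the value at \<open>Suc n\<close> is
  already F_n-measurable, which is the reason for the shift by \<open>Suc\<close> in the level
  conditions that follow.\<close>

definition square_sum ::
  "'a measure \<Rightarrow> (nat \<Rightarrow> 'a measure) \<Rightarrow> (nat \<Rightarrow> 'a \<Rightarrow> real) \<Rightarrow> nat \<Rightarrow> 'a \<Rightarrow> ennreal" where
  "square_sum M F f n x = (\<Sum>j<n. cond_var M F f j x)"

lemma square_sum_mono: "m \<le> n \<Longrightarrow> square_sum M F f m x \<le> square_sum M F f n x"
  unfolding square_sum_def by (intro sum_mono2) auto

lemma less_suminf_iff_square_sum:
  "A < (\<Sum>j. cond_var M F f j x) \<longleftrightarrow> (\<exists>n. A < square_sum M F f (Suc n) x)"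
proof -
  have "A < (\<Sum>j. cond_var M F f j x) \<longleftrightarrow> (\<exists>n. A < square_sum M F f n x)"
    unfolding suminf_eq_SUP square_sum_def by (simp add: less_SUP_iff)
  also have "\<dots> \<longleftrightarrow> (\<exists>n. A < square_sum M F f (Suc n) x)"
    using square_sum_mono[of _ "Suc _" M F f x] by (meson lessI less_imp_le order_less_le_trans)
  finally show ?thesis .
qed

text \<open>A partial sum over \<open>J\<close> changes only at indices of \<open>J\<close>, and at
  such an index j it is dominated by the full sum up to j, which is at most \<theta> by
  assumption.\<close>

lemma sum_layer_le:
  assumes "\<And>j. j \<in> J \<Longrightarrow> square_sum M F f (Suc j) x \<le> \<theta>"
  shows "(\<Sum>j. indicator J j * cond_var M F f j x) \<le> \<theta>"
proof -
  have "(\<Sum>j<n. indicator J j * cond_var M F f j x) \<le> \<theta>" for n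
  proof (induction n)
    case (Suc n)
    show ?case
    proof (cases "n \<in> J")
      case True
      have "(\<Sum>j<Suc n. indicator J j * cond_var M F f j x) \<le> square_sum M F f (Suc n) x"
        unfolding square_sum_def by (intro sum_mono) (simp split: split_indicator)
      also have "\<dots> \<le> \<theta>" using assms True by blast
      finally show ?thesis .
    qed (use Suc in simp)
  qed simp
  then show ?thesis
    unfolding suminf_eq_SUP by (intro SUP_least)
qed

text \<open>The index just before the partial sums of s(f)^2 first exceed \<open>A\<close>. Stopping
  one step early is possible because the next partial sum is known at this time, and it keeps the
  overshoot out of the stopped part.\<close>

definition hitting_index ::
  "'a measure \<Rightarrow> (nat \<Rightarrow> 'a measure) \<Rightarrow> (nat \<Rightarrow> 'a \<Rightarrow> real) \<Rightarrow> ennreal \<Rightarrow> 'a \<Rightarrow> enat" where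
  "hitting_index M F f A x = (if \<exists>n. A < square_sum M F f (Suc n) x
     then enat (LEAST n. A < square_sum M F f (Suc n) x) else \<infinity>)"

lemma hitting_index_le_iff:
  "hitting_index M F f A x \<le> enat n \<longleftrightarrow> A < square_sum M F f (Suc n) x"
proof
  assume "hitting_index M F f A x \<le> enat n"
  then have ex: "\<exists>n. A < square_sum M F f (Suc n) x"
    and le: "(LEAST n. A < square_sum M F f (Suc n) x) \<le> n"
    by (auto simp: hitting_index_def split: if_splits)
  from LeastI_ex[OF ex] square_sum_mono[of "Suc _" "Suc n" M F f x] le
  show "A < square_sum M F f (Suc n) x"
    by (meson Suc_le_mono order_less_le_trans)
next
  assume "A < square_sum M F f (Suc n) x"
  then show "hitting_index M F f A x \<le> enat n"
    by (auto simp: hitting_index_def intro: Least_le)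
qed

lemma B_set_hitting_index:
  "B_set M (hitting_index M F f A) = {x\<in>space M. A < (\<Sum>j. cond_var M F f j x)}"
  unfolding B_set_def less_suminf_iff_square_sum by (auto simp: hitting_index_def)

context filtered_prob_space
begin

lemma measurable_square_sum: "square_sum M F f (Suc n) \<in> borel_measurable (F n)"
  unfolding square_sum_def[abs_def]
proof (rule borel_measurable_sum)
  fix j assume "j \<in> {..<Suc n}"
  then show "cond_var M F f j \<in> borel_measurable (F n)"
    by (intro measurable_F_mono[OF measurable_cond_var_F]) auto
qed

lemma ext_stopping_time_hitting_index: "ext_stopping_time F (hitting_index M F f A)"
  unfolding ext_stopping_time_def hitting_index_le_iff
proof
  fix n
  note [measurable] = measurable_square_sum[of f n]
  show "Measurable.pred (F n) (\<lambda>x. A < square_sum M F f (Suc n) x)" by measurable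
qed

lemma martingales0_mdiff:
  assumes f: "f \<in> martingales0 M F"
  shows "mdiff f (Suc j) \<in> borel_measurable (F (Suc j))"
    and "integrable M (mdiff f (Suc j))"
    and "AE x in M. real_cond_exp M (F j) (mdiff f (Suc j)) x = 0"
proof -
  have fm: "f n \<in> borel_measurable (F n)" and fi: "integrable M (f n)" for n
    using f by (auto simp: martingales0_def)
  have fc: "AE x in M. real_cond_exp M (F m) (f n) x = f m x" if "m \<le> n" for m n
    using f that by (auto simp: martingales0_def)
  show "mdiff f (Suc j) \<in> borel_measurable (F (Suc j))"
    unfolding mdiff_def[abs_def] using measurable_F_mono[OF fm, of j "Suc j"] fm[of "Suc j"] by simp
  show "integrable M (mdiff f (Suc j))"
    unfolding mdiff_def[abs_def] using fi by simp
  have "AE x in M. real_cond_exp M (F j) (\<lambda>x. f (Suc j) x - f j x) x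
      = real_cond_exp M (F j) (f (Suc j)) x - real_cond_exp M (F j) (f j) x"
    using fi by (intro F.real_cond_exp_diff)
  then show "AE x in M. real_cond_exp M (F j) (mdiff f (Suc j)) x = 0"
    using fc[OF order_refl[of j]] fc[OF le_SucI[OF order_refl[of j]]] unfolding mdiff_def[abs_def]
    by eventually_elim simp
qed

text \<open>Membership of j in the layer is F_j-measurable, so multiplying d_(j+1) f by its
  indicator keeps conditional mean zero and multiplies the conditional variance by the same
  indicator. By \<open>sum_layer_le\<close> these variances add up to at most \<theta>, so the
  selected differences are bounded in L^2 and have a terminal value. The factor \<open>b\<close> is
  left free for the normalisation of atoms.\<close>

lemma layer_martingale:
  fixes A :: ennreal and \<theta> b :: real
  assumes f: "f \<in> martingales0 M F" and \<theta>: "0 \<le> \<theta>"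
  defines "J x \<equiv> {j. A < square_sum M F f (Suc j) x \<and> square_sum M F f (Suc j) x \<le> ennreal \<theta>}"
  obtains a where "integrable M a"
    "\<And>n. AE x in M. real_cond_exp M (F n) a x = b * (\<Sum>j<n. indicator (J x) j * mdiff f (Suc j) x)"
    "AE x in M. (\<Sum>j. cond_var M F (\<lambda>n. real_cond_exp M (F n) a) j x)
      \<le> ennreal (b\<^sup>2 * \<theta>) * indicator {x. \<exists>j. j \<in> J x} x"
proof -
  define d where "d j = mdiff f (Suc j)" for j
  have d: "d j \<in> borel_measurable (F (Suc j))" "integrable M (d j)"
      "AE x in M. real_cond_exp M (F j) (d j) x = 0" for j
    using martingales0_mdiff[OF f, of j] by (auto simp: d_def)
  have dM [measurable]: "d j \<in> borel_measurable M" for j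
    using d(1) by (rule measurable_F_M)
  define h :: "nat \<Rightarrow> 'a \<Rightarrow> real" where "h j x = indicator (J x) j" for j x
  have h_eq: "h j x = (if A < square_sum M F f (Suc j) x \<and> square_sum M F f (Suc j) x \<le> ennreal \<theta> then 1 else 0)" for j x
    by (simp add: h_def J_def)
  have hF [measurable]: "h j \<in> borel_measurable (F j)" for j
  proof -
    note [measurable] = measurable_square_sum[of f j]
    show ?thesis unfolding h_eq[abs_def] by measurable
  qed
  have hM [measurable]: "h j \<in> borel_measurable M" for j
    by (rule measurable_F_M[OF hF])
  have h01: "h j x = 0 \<or> h j x = 1" for j x by (simp add: h_eq)
  define Y where "Y j x = h j x * d j x" for j x
  have YF [measurable]: "Y j \<in> borel_measurable (F (Suc j))" for j
    unfolding Y_def[abs_def] using measurable_F_mono[OF hF, of j "Suc j"] d(1)[of j] by simp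
  have YM [measurable]: "Y j \<in> borel_measurable M" for j
    by (rule measurable_F_M[OF YF])
  have Ysq: "ennreal ((Y j x)\<^sup>2) = ennreal (h j x) * ennreal ((d j x)\<^sup>2)" for j x
    using h01[of j x] by (auto simp: Y_def)
  \<comment> \<open>Non-negative integrals are used because d_(j+1) f may fail to be square
    integrable; for Y_j square integrability follows from the bound derived here.\<close>
  have Y2: "(\<integral>\<^sup>+x. ennreal ((Y j x)\<^sup>2) \<partial>M) = (\<integral>\<^sup>+x. ennreal (h j x) * cond_var M F f j x \<partial>M)" for j
    unfolding Ysq cond_var_def d_def[symmetric]
    by (rule F.nn_cond_exp_intg[symmetric]) measurable
  have h_sum: "(\<Sum>j. ennreal (h j x) * cond_var M F f j x) \<le> ennreal \<theta> * indicator {x. \<exists>j. j \<in> J x} x" for x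
  proof (cases "\<exists>j. j \<in> J x")
    case True
    have "(\<Sum>j. indicator (J x) j * cond_var M F f j x) \<le> ennreal \<theta>"
      by (rule sum_layer_le) (simp add: J_def)
    with True show ?thesis by (simp add: h_def ennreal_indicator)
  qed (simp add: h_def)
  have Y2_sum: "(\<Sum>j. \<integral>\<^sup>+x. ennreal ((Y j x)\<^sup>2) \<partial>M) \<le> ennreal \<theta>"
  proof -
    have "(\<Sum>j. \<integral>\<^sup>+x. ennreal ((Y j x)\<^sup>2) \<partial>M) = (\<integral>\<^sup>+x. (\<Sum>j. ennreal (h j x) * cond_var M F f j x) \<partial>M)"
      unfolding Y2 by (rule nn_integral_suminf[symmetric]) measurable
    also have "\<dots> \<le> (\<integral>\<^sup>+x. ennreal \<theta> \<partial>M)"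
      using order_trans[OF h_sum] by (intro nn_integral_mono) (simp split: split_indicator)
    finally show ?thesis by (simp add: emeasure_space_1)
  qed
  have sq: "integrable M (\<lambda>x. (Y j x)\<^sup>2)" for j
  proof (rule integrableI_nn_integral_finite[where x="enn2real (\<integral>\<^sup>+x. ennreal ((Y j x)\<^sup>2) \<partial>M)"])
    have "(\<integral>\<^sup>+x. ennreal ((Y j x)\<^sup>2) \<partial>M) = (\<Sum>i\<in>{j}. \<integral>\<^sup>+x. ennreal ((Y i x)\<^sup>2) \<partial>M)" by simp
    also have "\<dots> \<le> (\<Sum>j. \<integral>\<^sup>+x. ennreal ((Y j x)\<^sup>2) \<partial>M)" by (rule sum_le_suminf) auto
    also note Y2_sum
    finally have "(\<integral>\<^sup>+x. ennreal ((Y j x)\<^sup>2) \<partial>M) < \<infinity>" by (rule le_less_trans) simp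
    then show "(\<integral>\<^sup>+x. ennreal ((Y j x)\<^sup>2) \<partial>M) = ennreal (enn2real (\<integral>\<^sup>+x. ennreal ((Y j x)\<^sup>2) \<partial>M))"
      by simp
  qed auto
  have bound: "(\<Sum>j<n. \<integral>x. (Y j x)\<^sup>2 \<partial>M) \<le> \<theta>" for n
  proof -
    have "ennreal (\<Sum>j<n. \<integral>x. (Y j x)\<^sup>2 \<partial>M) = (\<Sum>j<n. \<integral>\<^sup>+x. ennreal ((Y j x)\<^sup>2) \<partial>M)"
      using sq by (subst sum_ennreal[symmetric]) (auto simp: nn_integral_eq_integral)
    also have "\<dots> \<le> (\<Sum>j. \<integral>\<^sup>+x. ennreal ((Y j x)\<^sup>2) \<partial>M)" by (rule sum_le_suminf) auto
    also note Y2_sum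
    finally show ?thesis using \<theta> by simp
  qed
  have mart: "AE x in M. real_cond_exp M (F j) (Y j) x = 0" for j
  proof -
    have "\<bar>h j x * d j x\<bar> \<le> \<bar>d j x\<bar>" for x
      using h01[of j x] by auto
    then have "integrable M (\<lambda>x. h j x * d j x)"
      by (intro Bochner_Integration.integrable_bound[OF d(2)[of j]] AE_I2) auto
    then have "AE x in M. real_cond_exp M (F j) (\<lambda>x. h j x * d j x) x = h j x * real_cond_exp M (F j) (d j) x"
      by (intro F.real_cond_exp_mult) auto
    then show ?thesis
      using d(3)[of j] unfolding Y_def[abs_def] by eventually_elim simp
  qed
  obtain a0 where a0: "integrable M a0" "\<And>n. AE x in M. real_cond_exp M (F n) a0 x = (\<Sum>j<n. Y j x)"
    using L2_bounded_martingale_closed[OF YF sq mart bound] by blast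
  define a where "a x = b * a0 x" for x
  have a: "integrable M a" using a0(1) by (simp add: a_def[abs_def])
  have a_exp: "AE x in M. real_cond_exp M (F n) a x = b * (\<Sum>j<n. Y j x)" for n
    using a0(2)[of n] F.real_cond_exp_cmult[OF a0(1), of n b]
    unfolding a_def[abs_def] by eventually_elim simp
  let ?a = "\<lambda>n. real_cond_exp M (F n) a"
  have [measurable]: "?a n \<in> borel_measurable M" for n
    by (rule borel_measurable_cond_exp2)
  have cv: "AE x in M. cond_var M F ?a j x = ennreal (b\<^sup>2) * (ennreal (h j x) * cond_var M F f j x)" for j
  proof -
    have "AE x in M. ennreal ((mdiff ?a (Suc j) x)\<^sup>2) = (ennreal (b\<^sup>2) * ennreal (h j x)) * ennreal ((d j x)\<^sup>2)"
      using a_exp[of j] a_exp[of "Suc j"]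
    proof eventually_elim
      case (elim x)
      have "mdiff ?a (Suc j) x = b * Y j x"
        using elim by (simp add: mdiff_def distrib_left)
      then have "ennreal ((mdiff ?a (Suc j) x)\<^sup>2) = ennreal (b\<^sup>2) * ennreal ((Y j x)\<^sup>2)"
        by (simp add: power_mult_distrib ennreal_mult)
      then show ?case by (simp add: Ysq mult.assoc)
    qed
    then have "AE x in M. cond_var M F ?a j x
        = nn_cond_exp M (F j) (\<lambda>x. (ennreal (b\<^sup>2) * ennreal (h j x)) * ennreal ((d j x)\<^sup>2)) x"
      unfolding cond_var_def by (rule F.nn_cond_exp_cong) (auto simp: mdiff_def[abs_def])
    moreover have "AE x in M. (ennreal (b\<^sup>2) * ennreal (h j x)) * cond_var M F f j x
        = nn_cond_exp M (F j) (\<lambda>x. (ennreal (b\<^sup>2) * ennreal (h j x)) * ennreal ((d j x)\<^sup>2)) x"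
      unfolding cond_var_def d_def[symmetric] by (rule F.nn_cond_exp_prod) measurable
    ultimately show ?thesis by eventually_elim (simp add: mult.assoc)
  qed
  show thesis
  proof (rule that[OF a])
    show "AE x in M. ?a n x = b * (\<Sum>j<n. indicator (J x) j * mdiff f (Suc j) x)" for n
      using a_exp[of n] by (simp add: Y_def h_def d_def)
    have "AE x in M. \<forall>j. cond_var M F ?a j x = ennreal (b\<^sup>2) * (ennreal (h j x) * cond_var M F f j x)"
      using cv by (intro AE_all_countable[THEN iffD2] allI)
    then show "AE x in M. (\<Sum>j. cond_var M F ?a j x) \<le> ennreal (b\<^sup>2 * \<theta>) * indicator {x. \<exists>j. j \<in> J x} x"
    proof eventually_elim
      case (elim x)
      then have "(\<Sum>j. cond_var M F ?a j x) = ennreal (b\<^sup>2) * (\<Sum>j. ennreal (h j x) * cond_var M F f j x)"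
        by (simp add: ennreal_suminf_cmult)
      also have "\<dots> \<le> ennreal (b\<^sup>2) * (ennreal \<theta> * indicator {x. \<exists>j. j \<in> J x} x)"
        by (intro mult_left_mono h_sum) auto
      finally show ?case
        using \<theta> by (simp add: ennreal_mult mult.assoc)
    qed
  qed
qed

text \<open>The set where the conditional variance vanishes belongs to F_j, so the integral of
  |d_(j+1) f|^2 over it equals that of the conditional variance, namely 0. This handles differences
  that no layer captures.\<close>

lemma cond_var_zero_mdiff:
  assumes f: "f \<in> martingales0 M F"
  shows "AE x in M. cond_var M F f j x = 0 \<longrightarrow> mdiff f (Suc j) x = 0"
proof -
  have [measurable]: "mdiff f (Suc j) \<in> borel_measurable M"
    by (rule measurable_F_M[OF martingales0_mdiff(1)[OF f]])
  let ?z = "\<lambda>x. (if cond_var M F f j x = 0 then 1 else 0) :: ennreal"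
  have "(\<integral>\<^sup>+x. ?z x * ennreal ((mdiff f (Suc j) x)\<^sup>2) \<partial>M) = (\<integral>\<^sup>+x. ?z x * cond_var M F f j x \<partial>M)"
    unfolding cond_var_def[of M F f j] by (rule F.nn_cond_exp_intg[symmetric]) measurable
  also have "\<dots> = (\<integral>\<^sup>+x. 0 \<partial>M)"
    by (intro nn_integral_cong) simp
  finally have "(\<integral>\<^sup>+x. ?z x * ennreal ((mdiff f (Suc j) x)\<^sup>2) \<partial>M) = 0"
    by simp
  then have "AE x in M. ?z x * ennreal ((mdiff f (Suc j) x)\<^sup>2) = 0"
    by (subst (asm) nn_integral_0_iff_AE) auto
  then show ?thesis by eventually_elim (auto split: if_splits)
qed

lemma martingales0_eq_sum_mdiff:
  assumes f: "f \<in> martingales0 M F"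
  shows "AE x in M. f n x = (\<Sum>j<n. mdiff f (Suc j) x)"
proof -
  have "AE x in M. f 0 x = 0" using f by (simp add: martingales0_def)
  then show ?thesis
  proof eventually_elim
    case (elim x)
    show ?case
      by (induction n) (auto simp: elim mdiff_def)
  qed
qed

end

section \<open>Equivalence of the two quasi-norms\<close>

text \<open>The half-open dyadic intervals tile the positive reals. With u = sqrt y / c the strict
  inequality reads k' < log 2 u, so the unique index is the ceiling of log 2 u minus 1.\<close>

lemma dyadic_layer:
  assumes c: "0 < c" and y: "0 < y" "y < \<infinity>"
  shows "\<exists>k::int. \<forall>k'. ennreal ((c * 2 powr real_of_int k')\<^sup>2) < y \<and>
    y \<le> ennreal ((c * 2 powr real_of_int (k' + 1))\<^sup>2) \<longleftrightarrow> k' = k"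
proof -
  obtain z where z: "y = ennreal z" "0 < z"
    using y by (cases y) auto
  define u where "u = sqrt z / c"
  have u: "0 < u" using z c by (simp add: u_def)
  have zu: "z = (c * u)\<^sup>2" using z c by (simp add: u_def)
  have less_iff: "ennreal ((c * 2 powr real_of_int k)\<^sup>2) < y \<longleftrightarrow> real_of_int k < log 2 u" for k
  proof -
    have "ennreal ((c * 2 powr real_of_int k)\<^sup>2) < y \<longleftrightarrow> (c * 2 powr real_of_int k)\<^sup>2 < (c * u)\<^sup>2"
      unfolding z zu[symmetric] by (subst ennreal_less_iff) auto
    also have "\<dots> \<longleftrightarrow> c * 2 powr real_of_int k < c * u"
      unfolding not_le[symmetric] using c u by (subst power_mono_iff) auto
    also have "\<dots> \<longleftrightarrow> real_of_int k < log 2 u"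
      using c u by (simp add: less_log_iff)
    finally show ?thesis .
  qed
  show ?thesis
    unfolding not_less[symmetric] less_iff
    by (rule exI[of _ "\<lceil>log 2 u\<rceil> - 1"], intro allI iffI) linarith+
qed

context musielak_orlicz_prob
begin

text \<open>The set {g = \<infinity>} lies in every {g > \<alpha>}, so its mass is at most 1 at
  every level; \<open>phi_mass_le_1_bounded\<close> excludes this for sets of positive
  measure.\<close>

lemma WL_norm_finite_AE:
  assumes [measurable]: "g \<in> borel_measurable M" and fin: "WL_norm M \<phi> g < \<infinity>"
  shows "AE x in M. g x < \<infinity>"
proof -
  define E where "E = {x\<in>space M. g x = \<infinity>}"
  have E [measurable]: "E \<in> sets M" unfolding E_def by measurable
  obtain l where l: "0 < l"
    "(SUP \<alpha>\<in>{0<..}. phi_mass M \<phi> {x\<in>space M. ennreal \<alpha> < g x} (\<alpha> / l)) \<le> 1"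
    using fin unfolding WL_norm_def by (auto simp: Inf_less_iff)
  have le1: "phi_mass M \<phi> E t \<le> 1" if "0 < t" for t
  proof -
    have "phi_mass M \<phi> E (t * l / l) \<le> phi_mass M \<phi> {x\<in>space M. ennreal (t * l) < g x} (t * l / l)"
      by (rule phi_mass_mono_AE) (simp add: E_def)
    also have "\<dots> \<le> (SUP \<alpha>\<in>{0<..}. phi_mass M \<phi> {x\<in>space M. ennreal \<alpha> < g x} (\<alpha> / l))"
      using that l(1) by (intro SUP_upper) auto
    also note l(2)
    finally show ?thesis using l(1) by simp
  qed
  have "emeasure M E = 0"
  proof (rule ccontr)
    assume "emeasure M E \<noteq> 0"
    then obtain T where T: "0 < T" "\<And>t. 0 < t \<Longrightarrow> phi_mass M \<phi> E t \<le> 1 \<Longrightarrow> t \<le> T"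
      using phi_mass_le_1_bounded[OF E] by metis
    from T(2)[of "T + 1"] le1[of "T + 1"] T(1) show False by simp
  qed
  then have "AE x in M. x \<notin> E"
    by (intro AE_not_in) auto
  then show ?thesis
    using AE_space by eventually_elim (auto simp: E_def less_top)
qed

text \<open>Used for the size condition of atoms: a bound \<kappa> on B and vanishing elsewhere give
  a weighted mean at most \<kappa> for every t at once. \<open>PB\<close> makes the mass of B
  nonzero, so that it cancels.\<close>

lemma Lq_norm_le:
  assumes B [measurable]: "B \<in> sets M" and PB: "emeasure M B \<noteq> 0" and \<kappa>: "0 \<le> \<kappa>" and q: "0 < q"
    and [measurable]: "g \<in> borel_measurable M"
    and le: "AE x in M. g x \<le> ennreal \<kappa> * indicator B x"
  shows "Lq_norm M \<phi> q B g \<le> ennreal \<kappa>"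
proof (cases "q = \<infinity>")
  case True
  have "AE x in M. g x \<le> ennreal \<kappa>"
    using le by eventually_elim (auto split: split_indicator_asm)
  then show ?thesis
    using True by (simp add: Lq_norm_def esssup_I)
next
  case False
  define r where "r = enn2real q"
  have r: "0 < r"
    using q False by (cases q) (auto simp: r_def)
  have "ennpowr (1 / phi_mass M \<phi> B t * (\<integral>\<^sup>+x. ennpowr (g x) r * ennreal (\<phi> x t) \<partial>M)) (1 / r) \<le> ennreal \<kappa>"
    if t: "0 < t" for t
  proof -
    have [measurable]: "(\<lambda>x. \<phi> x t) \<in> borel_measurable M"
      using t by (simp add: measurable_phi)
    have "(\<integral>\<^sup>+x. ennpowr (g x) r * ennreal (\<phi> x t) \<partial>M)
        \<le> (\<integral>\<^sup>+x. ennreal (\<kappa> powr r) * (ennreal (\<phi> x t) * indicator B x) \<partial>M)"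
      using le
    proof (intro nn_integral_mono_AE, eventually_elim)
      case (elim x)
      show ?case
      proof (cases "x \<in> B")
        case True
        then have "ennpowr (g x) r \<le> ennpowr (ennreal \<kappa>) r"
          using elim r by (simp add: ennpowr_le_iff)
        with True show ?thesis
          using \<kappa> by (auto simp: ennpowr_ennreal intro: mult_right_mono)
      next
        case False
        with elim show ?thesis by (simp add: ennpowr_def)
      qed
    qed
    also have "\<dots> = ennreal (\<kappa> powr r) * phi_mass M \<phi> B t"
      unfolding phi_mass_def by (rule nn_integral_cmult) measurable
    finally have "1 / phi_mass M \<phi> B t * (\<integral>\<^sup>+x. ennpowr (g x) r * ennreal (\<phi> x t) \<partial>M)
        \<le> 1 / phi_mass M \<phi> B t * (ennreal (\<kappa> powr r) * phi_mass M \<phi> B t)"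
      by (rule mult_left_mono) simp
    also have "\<dots> = ennreal (\<kappa> powr r)"
    proof -
      obtain m where m: "phi_mass M \<phi> B t = ennreal m" "0 \<le> m"
        using phi_mass_finite[OF t, of B] by (cases "phi_mass M \<phi> B t") auto
      moreover have "m \<noteq> 0"
        using phi_mass_eq_0_iff[OF t B] PB m by auto
      moreover have "1 / ennreal m = ennreal (1 / m)" if "0 < m"
        using that divide_ennreal[of 1 m] by simp
      ultimately show ?thesis by (simp add: ennreal_mult[symmetric])
    qed
    finally show ?thesis
      using r \<kappa> by (simp add: ennpowr_le_ennreal_iff)
  qed
  then show ?thesis
    using False by (auto simp: Lq_norm_def r_def intro!: SUP_least)
qed

end

section \<open>Atoms from dyadic layers\<close>

context musielak_orlicz_martingales
begin

lemma layer_atom: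
  assumes f: "f \<in> martingales0 M F" and q: "0 < q" and \<tau>: "0 \<le> \<tau>1" "0 < \<tau>2"
  defines "\<nu> \<equiv> hitting_index M F f (ennreal (\<tau>1\<^sup>2))"
  defines "J x \<equiv> {j. ennreal (\<tau>1\<^sup>2) < square_sum M F f (Suc j) x \<and>
    square_sum M F f (Suc j) x \<le> ennreal (\<tau>2\<^sup>2)}"
  obtains a where "satom M F \<phi> q \<nu> a"
    "\<And>n. AE x in M. \<tau>2 * enn2real (L_norm M \<phi> (indicator (B_set M \<nu>))) * real_cond_exp M (F n) a x
      = (\<Sum>j<n. indicator (J x) j * mdiff f (Suc j) x)"
proof -
  define B where "B = B_set M \<nu>"
  have st: "ext_stopping_time F \<nu>"
    unfolding \<nu>_def by (rule ext_stopping_time_hitting_index)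
  have B [measurable]: "B \<in> sets M" unfolding B_def by (rule B_set_in_sets[OF st])
  have BJ: "x \<in> B" if "x \<in> space M" "j \<in> J x" for x j
    using that by (auto simp: B_def \<nu>_def J_def B_set_hitting_index less_suminf_iff_square_sum)
  define L where "L = enn2real (L_norm M \<phi> (indicator B))"
  \<comment> \<open>The slice has square function at most \<tau>2, so this factor brings it down to
    1 / L, the size allowed for an atom. If L = 0, then b = 0 and the atom has vanishing conditional
    expectations.\<close>
  define b where "b = 1 / (\<tau>2 * L)"
  obtain a where a: "integrable M a"
    and a_exp: "\<And>n. AE x in M. real_cond_exp M (F n) a x = b * (\<Sum>j<n. indicator (J x) j * mdiff f (Suc j) x)"
    and a_sq: "AE x in M. (\<Sum>j. cond_var M F (\<lambda>n. real_cond_exp M (F n) a) j x)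
      \<le> ennreal (b\<^sup>2 * \<tau>2\<^sup>2) * indicator {x. \<exists>j. j \<in> J x} x"
    unfolding J_def by (rule layer_martingale[OF f zero_le_power2[of \<tau>2], where A="ennreal (\<tau>1\<^sup>2)" and b=b]) blast
  show thesis
  proof (rule that)
    show "satom M F \<phi> q \<nu> a"
      unfolding satom_def
    proof (intro conjI allI)
      fix n
      show "AE x in M. enat n \<le> \<nu> x \<longrightarrow> real_cond_exp M (F n) a x = 0"
        using a_exp[of n]
      proof eventually_elim
        case (elim x)
        show ?case
        proof
          assume n: "enat n \<le> \<nu> x"
          have "j \<notin> J x" if "j < n" for j
          proof -
            \<comment> \<open>Before the stopping time the partial sum at \<open>Suc j\<close> has
              not exceeded \<tau>1^2, so j lies below the layer.\<close>
            have "enat j < \<nu> x" using that n by (simp add: less_le_trans[of "enat j" "enat n"])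
            then show ?thesis
              using hitting_index_le_iff[of M F f "ennreal (\<tau>1\<^sup>2)" x j] by (auto simp: \<nu>_def J_def)
          qed
          with elim show "real_cond_exp M (F n) a x = 0" by simp
        qed
      qed
    next
      show "emeasure M (B_set M \<nu>) = 0 \<or> Lq_norm M \<phi> q (B_set M \<nu>) (cond_square M F (\<lambda>n. real_cond_exp M (F n) a))
        \<le> inverse (L_norm M \<phi> (indicator (B_set M \<nu>)))"
      proof (cases "emeasure M B = 0")
        case False
        obtain L' where L': "0 < L'" "L_norm M \<phi> (indicator B) = ennreal L'"
          "inverse (L_norm M \<phi> (indicator B)) = ennreal (1 / L')"
          using L_norm_indicator_real[OF B False] by metis
        then have L: "L = L'" by (simp add: L_def)
        have "AE x in M. cond_square M F (\<lambda>n. real_cond_exp M (F n) a) x \<le> ennreal (1 / L) * indicator B x"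
          using a_sq AE_space
        proof eventually_elim
          case (elim x)
          show ?case
          proof (cases "\<exists>j. j \<in> J x")
            case True
            then have "(\<Sum>j. cond_var M F (\<lambda>n. real_cond_exp M (F n) a) j x) \<le> ennreal (b\<^sup>2 * \<tau>2\<^sup>2)"
              using elim by simp
            also have "b\<^sup>2 * \<tau>2\<^sup>2 = (1 / L)\<^sup>2"
              using \<tau> by (simp add: b_def power_divide power_mult_distrib)
            finally show ?thesis
              using True BJ elim L L' by (auto simp: cond_square_le_iff)
          next
            case False
            then have "(\<Sum>j. cond_var M F (\<lambda>n. real_cond_exp M (F n) a) j x) = 0"
              using elim by simp
            then show ?thesis by (simp only: cond_square_eq) (simp add: ennpowr_def)
          qed
        qed
        then have "Lq_norm M \<phi> q B (cond_square M F (\<lambda>n. real_cond_exp M (F n) a)) \<le> ennreal (1 / L)"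
          using L L' q False by (intro Lq_norm_le B) auto
        then show ?thesis using L L' by (simp add: B_def)
      qed (simp add: B_def)
    qed (rule a st)+
    fix n
    \<comment> \<open>When L = 0 the factor L b is 0 instead of 1 / \<tau>2. The identity survives
      because B is then null and the slice vanishes off B.\<close>
    have "AE x in M. L = 0 \<longrightarrow> x \<notin> B"
    proof (cases "emeasure M B = 0")
      case True
      then have "AE x in M. x \<notin> B" by (intro AE_not_in) auto
      then show ?thesis by eventually_elim simp
    next
      case False
      from L_norm_indicator_real[OF B False] have "L \<noteq> 0"
        by (metis L_def enn2real_ennreal less_imp_le less_irrefl)
      then show ?thesis by simp
    qed
    with a_exp[of n] AE_space
    show "AE x in M. \<tau>2 * enn2real (L_norm M \<phi> (indicator (B_set M \<nu>))) * real_cond_exp M (F n) a x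
      = (\<Sum>j<n. indicator (J x) j * mdiff f (Suc j) x)"
      unfolding B_def[symmetric] L_def[symmetric]
    proof eventually_elim
      case (elim x)
      show ?case
      proof (cases "L = 0")
        case True
        then have "j \<notin> J x" for j using elim BJ by blast
        with True show ?thesis by simp
      next
        case False
        then show ?thesis using elim \<tau> by (simp add: b_def)
      qed
    qed
  qed
qed

lemma atomic_decomp_exists:
  assumes f: "f \<in> WHs M F \<phi>" and q: "0 < q" and Ct: "0 < Ct"
  obtains a \<nu> where "atomic_decomp M F \<phi> q Ct f a \<nu>"
    "\<And>k. B_set M (\<nu> k) = {x\<in>space M. ennreal (Ct / 2 * 2 powr real_of_int k) < cond_square M F f x}"
proof -
  have fM: "f \<in> martingales0 M F" using f by (simp add: WHs_def)
  \<comment> \<open>The factor 1 / 2 makes the upper threshold \<tau>_(k+1) equal to Ct 2^k, which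
    is the factor prescribed in the coefficient of the k-th atom.\<close>
  define \<tau> where "\<tau> k = Ct / 2 * 2 powr real_of_int k" for k
  have \<tau>: "0 < \<tau> k" for k using Ct by (simp add: \<tau>_def)
  have \<tau>_Suc: "\<tau> (k + 1) = Ct * 2 powr real_of_int k" for k by (simp add: \<tau>_def powr_add)
  define \<nu> where "\<nu> k = hitting_index M F f (ennreal ((\<tau> k)\<^sup>2))" for k
  define J where "J k x = {j. ennreal ((\<tau> k)\<^sup>2) < square_sum M F f (Suc j) x \<and>
    square_sum M F f (Suc j) x \<le> ennreal ((\<tau> (k + 1))\<^sup>2)}" for k x
  have "\<exists>a. satom M F \<phi> q (\<nu> k) a \<and>
    (\<forall>n. AE x in M. \<tau> (k + 1) * enn2real (L_norm M \<phi> (indicator (B_set M (\<nu> k)))) * real_cond_exp M (F n) a x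
      = (\<Sum>j<n. indicator (J k x) j * mdiff f (Suc j) x))" for k
    unfolding \<nu>_def J_def
    by (rule layer_atom[OF fM q less_imp_le[OF \<tau>] \<tau>, of k "k + 1"]) blast
  then obtain a where atom: "\<And>k. satom M F \<phi> q (\<nu> k) (a k)"
    and a_exp: "\<And>k n. AE x in M. \<tau> (k + 1) * enn2real (L_norm M \<phi> (indicator (B_set M (\<nu> k)))) *
      real_cond_exp M (F n) (a k) x = (\<Sum>j<n. indicator (J k x) j * mdiff f (Suc j) x)"
    using choice[of "\<lambda>k a. satom M F \<phi> q (\<nu> k) a \<and> (\<forall>n. AE x in M. \<tau> (k + 1) *
      enn2real (L_norm M \<phi> (indicator (B_set M (\<nu> k)))) * real_cond_exp M (F n) a x
      = (\<Sum>j<n. indicator (J k x) j * mdiff f (Suc j) x))"] by blast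
  have coeff: "atom_coeff M \<phi> Ct \<nu> k = \<tau> (k + 1) * enn2real (L_norm M \<phi> (indicator (B_set M (\<nu> k))))" for k
    by (simp add: atom_coeff_def \<tau>_Suc powr_real_of_int')
  have "AE x in M. cond_square M F f x < \<infinity>"
    using f by (intro WL_norm_finite_AE) (auto simp: WHs_def WHs_norm_def)
  moreover have "AE x in M. \<forall>j. cond_var M F f j x = 0 \<longrightarrow> mdiff f (Suc j) x = 0"
    using cond_var_zero_mdiff[OF fM] by (intro AE_all_countable[THEN iffD2] allI)
  \<comment> \<open>Finiteness of the weak norm makes every partial sum finite almost everywhere, so
    each positive one lies in exactly one layer and the sum over k has a single non-zero term at
    most. A zero partial sum lies in no layer, but then the difference vanishes as well.\<close>
  ultimately have layers: "AE x in M. \<forall>j. ((\<lambda>k. indicator (J k x) j * mdiff f (Suc j) x) has_sum mdiff f (Suc j) x) UNIV"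
  proof eventually_elim
    case (elim x)
    show ?case
    proof
      fix j
      let ?y = "square_sum M F f (Suc j) x"
      have "?y \<le> (\<Sum>j. cond_var M F f j x)"
        unfolding square_sum_def by (rule sum_le_suminf) auto
      moreover have "(\<Sum>j. cond_var M F f j x) < \<infinity>"
        using elim(1) by (auto simp: cond_square_eq ennpowr_def less_top[symmetric] split: if_splits)
      ultimately have fin: "?y < \<infinity>" by (rule le_less_trans)
      show "((\<lambda>k. indicator (J k x) j * mdiff f (Suc j) x) has_sum mdiff f (Suc j) x) UNIV"
      proof (cases "?y = 0")
        case True
        then have "mdiff f (Suc j) x = 0"
          using elim(2) by (simp add: square_sum_def)
        then show ?thesis by simp
      next
        case False
        then have "0 < ?y" by (simp add: zero_less_iff_neq_zero)
        from dyadic_layer[OF half_gt_zero[OF Ct] this fin]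
        obtain k where "\<forall>k'. j \<in> J k' x \<longleftrightarrow> k' = k"
          unfolding J_def mem_Collect_eq \<tau>_def by blast
        then show ?thesis
          by (intro has_sum_finite_neutralI[of "{k}"]) (auto simp: indicator_def)
      qed
    qed
  qed
  have "atomic_decomp M F \<phi> q Ct f a \<nu>"
    unfolding atomic_decomp_def
  proof (intro conjI allI atom)
    fix n
    have "AE x in M. \<forall>k. atom_coeff M \<phi> Ct \<nu> k * real_cond_exp M (F n) (a k) x
        = (\<Sum>j<n. indicator (J k x) j * mdiff f (Suc j) x)"
      unfolding coeff using a_exp by (intro AE_all_countable[THEN iffD2] allI)
    with layers martingales0_eq_sum_mdiff[OF fM, of n]
    show "AE x in M. ((\<lambda>k. atom_coeff M \<phi> Ct \<nu> k * real_cond_exp M (F n) (a k) x) has_sum f n x) UNIV"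
    proof eventually_elim
      case (elim x)
      \<comment> \<open>The sum over j is finite, so it is exchanged with the sum over k by
        induction.\<close>
      have "((\<lambda>k. \<Sum>j<m. indicator (J k x) j * mdiff f (Suc j) x) has_sum (\<Sum>j<m. mdiff f (Suc j) x)) UNIV" for m
      proof (induction m)
        case (Suc m)
        from has_sum_add[OF Suc elim(1)[rule_format, of m]] show ?case by simp
      qed simp
      then show ?case using elim by simp
    qed
  qed
  moreover have "B_set M (\<nu> k) = {x\<in>space M. ennreal (Ct / 2 * 2 powr real_of_int k) < cond_square M F f x}" for k
    unfolding \<nu>_def B_set_hitting_index \<tau>_def[symmetric] not_le[symmetric]
    using \<tau>[of k] by (simp add: cond_square_le_iff)
  ultimately show thesis by (rule that)
qed

section \<open>The two norm inequalities and the theorem\<close>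

lemma WHat_norm_le_WHs_norm:
  assumes f: "f \<in> WHs M F \<phi>" and q: "0 < q" and Ct: "0 < Ct"
  shows "f \<in> WHat M F \<phi> q Ct" "WHat_norm M F \<phi> q Ct f \<le> ennreal (2 / Ct) * WHs_norm M F \<phi> f"
proof -
  obtain a \<nu> where dec: "atomic_decomp M F \<phi> q Ct f a \<nu>"
    and B: "\<And>k. B_set M (\<nu> k) = {x\<in>space M. ennreal (Ct / 2 * 2 powr real_of_int k) < cond_square M F f x}"
    using atomic_decomp_exists[OF assms] by blast
  have le: "WHat_norm M F \<phi> q Ct f \<le> ennreal (2 / Ct) * ennreal l"
    if l: "0 < l" "(SUP \<alpha>\<in>{0<..}. phi_mass M \<phi> {x\<in>space M. ennreal \<alpha> < cond_square M F f x} (\<alpha> / l)) \<le> 1" for l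
  proof -
    have "phi_mass M \<phi> (B_set M (\<nu> k)) (2 powi k / (2 / Ct * l)) \<le> 1" for k
    proof -
      \<comment> \<open>\<open>B_set M (\<nu> k)\<close> is the level set {s(f) > \<alpha>} for
        \<alpha> = (Ct / 2) 2^k, so every l admissible for the weak norm makes (2 / Ct) l admissible
        for this decomposition.\<close>
      have eq: "2 powi k / (2 / Ct * l) = (Ct / 2 * 2 powr real_of_int k) / l"
        by (simp add: powr_real_of_int')
      have "phi_mass M \<phi> (B_set M (\<nu> k)) (2 powi k / (2 / Ct * l))
          \<le> (SUP \<alpha>\<in>{0<..}. phi_mass M \<phi> {x\<in>space M. ennreal \<alpha> < cond_square M F f x} (\<alpha> / l))"
        unfolding B eq using Ct by (intro SUP_upper2[of "Ct / 2 * 2 powr real_of_int k"]) simp_all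
      with l(2) show ?thesis by (rule order_trans[rotated])
    qed
    then have "(SUP k. phi_mass M \<phi> (B_set M (\<nu> k)) (2 powi k / (2 / Ct * l))) \<le> 1"
      by (intro SUP_least)
    then have "Inf (ennreal ` {l. 0 < l \<and> (SUP k. phi_mass M \<phi> (B_set M (\<nu> k)) (2 powi k / l)) \<le> 1})
        \<le> ennreal (2 / Ct * l)"
      using l(1) Ct by (intro Inf_lower imageI) simp
    then have "WHat_norm M F \<phi> q Ct f \<le> ennreal (2 / Ct * l)"
      unfolding WHat_norm_def using dec by (intro INF_lower2[of "(a, \<nu>)"]) auto
    then show ?thesis using l(1) Ct by (subst ennreal_mult[symmetric]) auto
  qed
  show le': "WHat_norm M F \<phi> q Ct f \<le> ennreal (2 / Ct) * WHs_norm M F \<phi> f"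
  proof -
    \<comment> \<open>The constant is moved to the left so that the weak norm stands alone as an
      infimum to be bounded from below.\<close>
    have "ennreal (Ct / 2) * WHat_norm M F \<phi> q Ct f \<le> WHs_norm M F \<phi> f"
      unfolding WHs_norm_def WL_norm_def
    proof (rule Inf_greatest, clarify)
      fix l :: real
      assume l: "0 < l" "(SUP \<alpha>\<in>{0<..}. phi_mass M \<phi> {x\<in>space M. ennreal \<alpha> < cond_square M F f x} (\<alpha> / l)) \<le> 1"
      have "ennreal (Ct / 2) * WHat_norm M F \<phi> q Ct f \<le> ennreal (Ct / 2) * (ennreal (2 / Ct) * ennreal l)"
        by (intro mult_left_mono le l) simp
      then show "ennreal (Ct / 2) * WHat_norm M F \<phi> q Ct f \<le> ennreal l"
        using Ct l by (simp add: ennreal_mult[symmetric])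
    qed
    then have "ennreal (2 / Ct) * (ennreal (Ct / 2) * WHat_norm M F \<phi> q Ct f) \<le> ennreal (2 / Ct) * WHs_norm M F \<phi> f"
      by (intro mult_left_mono) auto
    then show ?thesis
      using Ct by (simp add: mult.assoc[symmetric] ennreal_mult[symmetric])
  qed
  have "WHs_norm M F \<phi> f < \<infinity>" using f by (simp add: WHs_def)
  then have "ennreal (2 / Ct) * WHs_norm M F \<phi> f < \<infinity>"
    by (simp add: ennreal_mult_less_top)
  with le' have "WHat_norm M F \<phi> q Ct f < \<infinity>" by (rule le_less_trans)
  then show "f \<in> WHat M F \<phi> q Ct"
    using f dec by (auto simp: WHat_def WHs_def)
qed

text \<open>With the constant on the left the claim is a lower bound for an infimum and can be
  checked for each decomposition and each admissible l. If f has no decomposition, the infimum is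
  infinite.\<close>

lemma WHs_norm_le_WHat_norm:
  assumes q: "q > ennreal (max p_up 1)" and Ct: "0 < Ct"
  obtains N where "1 \<le> N"
    "\<And>f. f \<in> martingales0 M F \<Longrightarrow> ennreal (1 / N) * WHs_norm M F \<phi> f \<le> WHat_norm M F \<phi> q Ct f"
proof (rule WHs_norm_le_atomic[OF q Ct])
  fix N :: real
  assume N: "1 \<le> N" "\<And>f a \<nu> l. f \<in> martingales0 M F \<Longrightarrow> atomic_decomp M F \<phi> q Ct f a \<nu> \<Longrightarrow> 0 < l \<Longrightarrow>
    (SUP k. phi_mass M \<phi> (B_set M (\<nu> k)) (2 powi k / l)) \<le> 1 \<Longrightarrow> WHs_norm M F \<phi> f \<le> ennreal (N * l)"
  show thesis
  proof (rule that[OF N(1)])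
    fix f assume f: "f \<in> martingales0 M F"
    show "ennreal (1 / N) * WHs_norm M F \<phi> f \<le> WHat_norm M F \<phi> q Ct f"
      unfolding WHat_norm_def
    proof (intro INF_greatest, clarify, rule Inf_greatest, clarify)
      fix a \<nu> and l :: real
      assume dec: "atomic_decomp M F \<phi> q Ct f a \<nu>" and l: "0 < l"
        "(SUP k. phi_mass M \<phi> (B_set M (\<nu> k)) (2 powi k / l)) \<le> 1"
      have "ennreal (1 / N) * WHs_norm M F \<phi> f \<le> ennreal (1 / N) * ennreal (N * l)"
        by (intro mult_left_mono N(2)[OF f dec l]) simp
      also have "\<dots> = ennreal l"
        using N(1) l(1) by (simp add: ennreal_mult[symmetric])
      finally show "ennreal (1 / N) * WHs_norm M F \<phi> f \<le> ennreal l" .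
    qed
  qed
qed

end

theorem theorem3p1:
  fixes M :: "'a measure" and F :: "nat \<Rightarrow> 'a measure"
    and \<phi> :: "'a \<Rightarrow> real \<Rightarrow> real" and p_lo p_up Ct :: real and q :: ennreal
  assumes "prob_space M"
    and "filtration (space M) F" and "\<And>n. subalgebra M (F n)"
    and "musielak_orlicz M \<phi>"
    and "\<And>t. t > 0 \<Longrightarrow> (\<integral>\<^sup>+x. ennreal (\<phi> x t) \<partial>M) < \<infinity>"
    and "p_lo > 0" and "uniformly_lower_type M \<phi> p_lo"
    and "p_up > 0" and "uniformly_upper_type M \<phi> p_up"
    and "q > ennreal (max p_up 1)"
    and "Ct > 0"
  shows "WHs M F \<phi> = WHat M F \<phi> q Ct \<and>
    (\<exists>C::real. C \<ge> 1 \<and> (\<forall>f\<in>WHs M F \<phi>.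
       ennreal (1 / C) * WHs_norm M F \<phi> f \<le> WHat_norm M F \<phi> q Ct f \<and>
       WHat_norm M F \<phi> q Ct f \<le> ennreal C * WHs_norm M F \<phi> f))"
proof -
  interpret prob_space M by fact
  interpret musielak_orlicz_martingales M F \<phi> p_lo p_up
    by unfold_locales
      (fact assms filtration.space_F[OF assms(2)] filtration.sets_F_mono[OF assms(2)])+
  have q: "0 < q"
    using assms(10) by (rule le_less_trans[rotated]) simp
  obtain N where N: "1 \<le> N"
    "\<And>f. f \<in> martingales0 M F \<Longrightarrow> ennreal (1 / N) * WHs_norm M F \<phi> f \<le> WHat_norm M F \<phi> q Ct f"
    using WHs_norm_le_WHat_norm[OF assms(10,11)] by metis
  have eq: "WHs M F \<phi> = WHat M F \<phi> q Ct"
  proof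
    show "WHs M F \<phi> \<subseteq> WHat M F \<phi> q Ct"
      using WHat_norm_le_WHs_norm(1)[OF _ q assms(11)] by blast
    show "WHat M F \<phi> q Ct \<subseteq> WHs M F \<phi>"
    proof
      fix f assume f: "f \<in> WHat M F \<phi> q Ct"
      then have fM: "f \<in> martingales0 M F" and fin: "WHat_norm M F \<phi> q Ct f < \<infinity>"
        by (auto simp: WHat_def)
      have "ennreal (1 / N) * WHs_norm M F \<phi> f < \<infinity>"
        using N(2)[OF fM] fin by (rule le_less_trans)
      then have "WHs_norm M F \<phi> f < \<infinity>"
        using N(1) by (auto simp: ennreal_mult_less_top)
      with fM show "f \<in> WHs M F \<phi>" by (simp add: WHs_def)
    qed
  qed
  define C where "C = max N (2 / Ct)"
  have "ennreal (1 / C) * WHs_norm M F \<phi> f \<le> WHat_norm M F \<phi> q Ct f \<and>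
      WHat_norm M F \<phi> q Ct f \<le> ennreal C * WHs_norm M F \<phi> f" if f: "f \<in> WHs M F \<phi>" for f
  proof
    have "ennreal (1 / C) * WHs_norm M F \<phi> f \<le> ennreal (1 / N) * WHs_norm M F \<phi> f"
      using N(1) by (intro mult_right_mono ennreal_leI divide_left_mono) (auto simp: C_def)
    also have "\<dots> \<le> WHat_norm M F \<phi> q Ct f"
      using f by (intro N(2)) (simp add: WHs_def)
    finally show "ennreal (1 / C) * WHs_norm M F \<phi> f \<le> WHat_norm M F \<phi> q Ct f" .
    have "WHat_norm M F \<phi> q Ct f \<le> ennreal (2 / Ct) * WHs_norm M F \<phi> f"
      by (rule WHat_norm_le_WHs_norm(2)[OF f q assms(11)])
    also have "\<dots> \<le> ennreal C * WHs_norm M F \<phi> f"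
      by (intro mult_right_mono ennreal_leI) (auto simp: C_def)
    finally show "WHat_norm M F \<phi> q Ct f \<le> ennreal C * WHs_norm M F \<phi> f" .
  qed
  moreover have "1 \<le> C" using N(1) by (simp add: C_def)
  ultimately show ?thesis using eq by blast
qed

end
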